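(* Let $S(t)$ be an asymptotically compact semiflow on a complete metric space $X$, let $\mathscr{A}$ be an attractor of $S(t)$ with attraction basin $\Omega=\Omega(\mathscr{A})$ and Morse decomposition $\mathcal{M}=\{M_1,\dots,M_l\}$, and let $V$ be a strict Morse-Lyapunov function of $\mathcal{M}$ on $\Omega$ with generalized critical values $c_k=V(M_k)$, $1\le k\le l$. Let $a<c_1<c_2<\cdots<c_l<b$ and put $$m_q=\sum_{k=1}^l\operatorname{rank}C_q(M_k),\qquad \beta_q=\operatorname{rank}H_q(V_b,V_a)=\operatorname{rank}H_q(V_b),\qquad q=0,1,2,\dots.$$ Suppose that all the critical groups of each Morse set $M_k$ are of finite rank. Then for any $q\ge0$, $$m_q-m_{q-1}+\cdots+(-1)^qm_0\ \ge\ \beta_q-\beta_{q-1}+\cdots+(-1)^q\beta_0.$$ Moreover, $$\sum_{q=0}^\infty(-1)^qm_q=\sum_{q=0}^\infty(-1)^q\beta_q,$$ provided that the left-hand side of this equation is convergent.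
   Context: $H_*$ denotes singular homology with coefficients in a given abelian group $\mathscr{G}$. $(X,d)$ is a complete metric space. $C(U)$ denotes the continuous real-valued functions on $U$. A semiflow on $X$ is a continuous map $S:[0,\infty)\times X\to X$, written $S(t)x=S(t,x)$, with $S(0)x=x$ and $S(t+s)x=S(t)S(s)x$ for all $t,s\ge 0$, $x\in X$. It is asymptotically compact if, whenever $(x_n)$ is a bounded sequence in $X$, $t_n\to+\infty$ and $(S(t_n)x_n)$ is bounded, the sequence $(S(t_n)x_n)$ has a convergent subsequence. For $A\subset X$ and $\varepsilon>0$, $B(A,\varepsilon)=\{y\in X: d(y,A)<\varepsilon\}$. A set $U$ is a neighborhood of $A$ if $\overline{A}\subset\operatorname{int}U$. $A$ attracts $B\subset X$ if for every $\varepsilon>0$ there is $T>0$ with $S(t)B\subset B(A,\varepsilon)$ for all $t>T$. $A$ is invariant if $S(t)A=A$ for all $t\ge0$. An attractor is a compact invariant set that attracts some neighborhood of itself. The attraction basin of $A$ is $\Omega(A)=\{x: \lim_{t\to\infty}d(S(t)x,A)=0\}$ (an open set when $A$ is an attractor). Morse decompositions: let $\mathscr{A}$ be an attractor. A compact set $A\subset\mathscr{A}$ is an attractor of $S(t)$ in $\mathscr{A}$ if it is an attractor of the restriction of $S(t)$ to $\mathscr{A}$ (the empty set is allowed). Its dual repeller is $A^*=\{x\in\mathscr{A}:\omega(x)\cap A=\emptyset\}$, where $\omega(x)=\{y:\exists\,t_n\to+\infty,\ S(t_n)x\to y\}$. An ordered collection $\mathcal{M}=\{M_1,\dots,M_l\}$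 of subsets of $\mathscr{A}$ is a Morse decomposition of $\mathscr{A}$, with Morse sets $M_k$, if there is a strictly increasing sequence $\emptyset=A_0\subsetneq A_1\subsetneq\cdots\subsetneq A_l=\mathscr{A}$ of attractors of $S(t)$ in $\mathscr{A}$ such that $M_k=A_k\cap A_{k-1}^*$ for $1\le k\le l$. Put $\mathcal{R}=\bigcup_{1\le k\le l}M_k$. A function $V\in C(\Omega)$ is a Morse-Lyapunov function of $\mathcal{M}$ on $\Omega$ if (1) $V$ is constant on each $M_k$ and (2) $t\mapsto V(S(t)x)$ is strictly decreasing in $t$ for each $x\in\Omega\setminus\mathcal{R}$. It is strict if in addition $V(M_1)<V(M_2)<\cdots<V(M_l)$, where $V(M_k)$ is the constant value of $V$ on $M_k$. The generalized critical values of $V$ are the numbers $c_k=V(M_k)$. For $a\in\mathbb{R}$, $V_a=\{x\in\Omega: V(x)\le a\}$; for $a<c_1$ one has $V_a=\emptyset$. Critical groups: let $V$ be a strict Morse-Lyapunov function of $\mathcal{M}$ and let $a'<c_k<b'$ be such that $c_k$ is the unique generalized critical value of $V$ in $[a',b']$. The critical group $C_*(M_k)$ is defined by $C_q(M_k)=H_q(V_{b'},V_{a'})$, $q=0,1,2,\dots$; up to isomorphism it does not depend on the choice of $a',b'$ or of $V$. *)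

theory Defs
  imports
    "HOL-Analysis.Analysis"
    "HOL-Homology.Homology"
    "HOL-Library.Extended_Nat"
begin

section \<open>Singular homology with coefficients in an abelian group\<close>

text \<open>
  \<^theory>\<open>HOL-Homology.Homology\<close> only treats integer coefficients. The definitions below are the
  ones of that library with the coefficient group \<open>\<int>\<close> replaced by an arbitrary abelian group,
  given as a type of class \<^class>\<open>ab_group_add\<close>. Simplices and their faces are the library's.
\<close>

type_synonym ('a, 'g) gchain = "((nat \<Rightarrow> real) \<Rightarrow> 'a) \<Rightarrow>\<^sub>0 'g"

definition coeff_chain :: "nat \<Rightarrow> 'a topology \<Rightarrow> ('a, 'g::ab_group_add) gchain \<Rightarrow> bool" where
  "coeff_chain p X c \<longleftrightarrow> Poly_Mapping.keys c \<subseteq> singular_simplex_set p X"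

definition coeff_boundary ::
    "nat \<Rightarrow> ('a, 'g::ab_group_add) gchain \<Rightarrow> ('a, 'g) gchain" where
  "coeff_boundary p c =
     (if p = 0 then 0
      else \<Sum>f\<in>Poly_Mapping.keys c. \<Sum>k\<le>p.
             Poly_Mapping.single (singular_face p k f)
               (if even k then Poly_Mapping.lookup c f else - Poly_Mapping.lookup c f))"

definition coeff_relcycle ::
    "nat \<Rightarrow> 'a topology \<Rightarrow> 'a set \<Rightarrow> ('a, 'g::ab_group_add) gchain \<Rightarrow> bool" where
  "coeff_relcycle p X A c \<longleftrightarrow>
     coeff_chain p X c \<and> coeff_chain (p - 1) (subtopology X A) (coeff_boundary p c)"

definition coeff_relboundary ::
    "nat \<Rightarrow> 'a topology \<Rightarrow> 'a set \<Rightarrow> ('a, 'g::ab_group_add) gchain \<Rightarrow> bool" where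
  "coeff_relboundary p X A c \<longleftrightarrow>
     (\<exists>d. coeff_chain (Suc p) X d \<and> coeff_chain p (subtopology X A) (coeff_boundary (Suc p) d - c))"

definition coeff_relcycle_group ::
    "nat \<Rightarrow> 'a topology \<Rightarrow> 'a set \<Rightarrow> ('a, 'g::ab_group_add) gchain monoid" where
  "coeff_relcycle_group p X A =
     \<lparr>carrier = Collect (coeff_relcycle p X A), monoid.mult = (+), one = 0\<rparr>"

definition coeff_relhomology ::
    "nat \<Rightarrow> 'a topology \<Rightarrow> 'a set \<Rightarrow> ('a, 'g::ab_group_add) gchain set monoid" where
  "coeff_relhomology p X A = coeff_relcycle_group p X A Mod Collect (coeff_relboundary p X A)"

abbreviation coeff_homology ::
    "nat \<Rightarrow> 'a topology \<Rightarrow> ('a, 'g::ab_group_add) gchain set monoid" where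
  "coeff_homology p X \<equiv> coeff_relhomology p X {}"

text \<open>For integer coefficients this is the homology of the library.\<close>

lemma coeff_boundary_int: "coeff_boundary p c = chain_boundary p (c::'a Simplices.chain)"
proof -
  have s: "Poly_Mapping.single f (if even k then n else - n) = frag_cmul n (frag_cmul ((-1)^k) (frag_of f))" for f::"(nat \<Rightarrow> real) \<Rightarrow> 'a" and n k
    by (rule poly_mapping_eqI) (auto simp: lookup_single when_def)
  show ?thesis unfolding coeff_boundary_def chain_boundary_def frag_extend_def s
    by (simp add: frag_cmul_sum)
qed

lemma coeff_relhomology_int: "relative_homology_group (int q) X A = coeff_relhomology q X A"
proof -
  have c: "coeff_relcycle q X A = singular_relcycle q X A"
    by (auto simp: fun_eq_iff coeff_relcycle_def singular_relcycle_def coeff_chain_def coeff_boundary_int singular_chain_def mod_subset_def)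
  have d: "coeff_relboundary q X A = singular_relboundary q X A"
    by (auto simp: fun_eq_iff coeff_relboundary_def singular_relboundary_def coeff_chain_def coeff_boundary_int singular_chain_def mod_subset_def)
  have e: "relcycle_group q X A = coeff_relcycle_group q X A"
    by (rule monoid.equality) (auto simp: coeff_relcycle_group_def c fun_eq_iff)
  show ?thesis by (simp add: relative_homology_group_def coeff_relhomology_def d e)
qed

section \<open>Rank of an abelian group\<close>

definition Z_independent :: "('b, 'm) monoid_scheme \<Rightarrow> 'b set \<Rightarrow> bool" where
  "Z_independent G B \<longleftrightarrow>
     finite B \<and> B \<subseteq> carrier G \<and>
     (\<forall>n :: 'b \<Rightarrow> int. finprod G (\<lambda>x. x [^]\<^bsub>G\<^esub> n x) B = \<one>\<^bsub>G\<^esub> \<longrightarrow> (\<forall>x\<in>B. n x = 0))"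

text \<open>The rank is the maximal number of elements that are linearly independent over \<open>\<int>\<close>;
  it is \<open>\<infinity>\<close> when there is no finite maximum.\<close>

definition ab_rank :: "('b, 'm) monoid_scheme \<Rightarrow> enat" where
  "ab_rank G = (SUP B\<in>Collect (Z_independent G). enat (card B))"

section \<open>Semiflows and attractors\<close>

definition semiflow :: "(real \<Rightarrow> 'a::metric_space \<Rightarrow> 'a) \<Rightarrow> bool" where
  "semiflow S \<longleftrightarrow>
     continuous_on ({0..} \<times> UNIV) (\<lambda>(t, x). S t x) \<and>
     (\<forall>x. S 0 x = x) \<and>
     (\<forall>t\<ge>0. \<forall>s\<ge>0. \<forall>x. S (t + s) x = S t (S s x))"

definition asymptotically_compact :: "(real \<Rightarrow> 'a::metric_space \<Rightarrow> 'a) \<Rightarrow> bool" where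
  "asymptotically_compact S \<longleftrightarrow>
     (\<forall>(x :: nat \<Rightarrow> 'a) (t :: nat \<Rightarrow> real).
        bounded (range x) \<and> (\<forall>n. 0 \<le> t n) \<and> filterlim t at_top sequentially \<and>
        bounded (range (\<lambda>n. S (t n) (x n))) \<longrightarrow>
        (\<exists>r. strict_mono r \<and> convergent ((\<lambda>n. S (t n) (x n)) \<circ> r)))"

text \<open>The condition \<open>A \<noteq> {}\<close> implements the convention \<open>d(y, \<emptyset>) = \<infinity>\<close>,
  whereas \<open>infdist y {} = 0\<close>; likewise in the definition of the basin.\<close>

definition eps_nbhd :: "'a::metric_space set \<Rightarrow> real \<Rightarrow> 'a set" where
  "eps_nbhd A \<epsilon> = {y. A \<noteq> {} \<and> infdist y A < \<epsilon>}"

definition attracts ::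
    "(real \<Rightarrow> 'a::metric_space \<Rightarrow> 'a) \<Rightarrow> 'a set \<Rightarrow> 'a set \<Rightarrow> bool" where
  "attracts S A B \<longleftrightarrow> (\<forall>\<epsilon>>0. \<exists>T>0. \<forall>t>T. S t ` B \<subseteq> eps_nbhd A \<epsilon>)"

definition flow_invariant :: "(real \<Rightarrow> 'a \<Rightarrow> 'a) \<Rightarrow> 'a set \<Rightarrow> bool" where
  "flow_invariant S A \<longleftrightarrow> (\<forall>t\<ge>0. S t ` A = A)"

definition neighborhood_in :: "'a::topological_space set \<Rightarrow> 'a set \<Rightarrow> 'a set \<Rightarrow> bool" where
  "neighborhood_in Y A U \<longleftrightarrow>
     U \<subseteq> Y \<and> top_of_set Y closure_of A \<subseteq> top_of_set Y interior_of U"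

text \<open>Attractors of the restriction of the semiflow to an invariant set \<open>Y\<close>: the neighborhood is
  taken in the metric space \<open>Y\<close>.\<close>

definition attractor_in ::
    "'a set \<Rightarrow> (real \<Rightarrow> 'a::metric_space \<Rightarrow> 'a) \<Rightarrow> 'a set \<Rightarrow> bool" where
  "attractor_in Y S A \<longleftrightarrow>
     A \<subseteq> Y \<and> compact A \<and> flow_invariant S A \<and>
     (\<exists>U. neighborhood_in Y A U \<and> attracts S A U)"

abbreviation attractor :: "(real \<Rightarrow> 'a::metric_space \<Rightarrow> 'a) \<Rightarrow> 'a set \<Rightarrow> bool" where
  "attractor \<equiv> attractor_in UNIV"

definition attraction_basin :: "(real \<Rightarrow> 'a::metric_space \<Rightarrow> 'a) \<Rightarrow> 'a set \<Rightarrow> 'a set" where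
  "attraction_basin S A = {x. A \<noteq> {} \<and> ((\<lambda>t. infdist (S t x) A) \<longlongrightarrow> 0) at_top}"

section \<open>Morse decompositions\<close>

definition omega_limit :: "(real \<Rightarrow> 'a::metric_space \<Rightarrow> 'a) \<Rightarrow> 'a \<Rightarrow> 'a set" where
  "omega_limit S x =
     {y. \<exists>t :: nat \<Rightarrow> real. (\<forall>n. 0 \<le> t n) \<and> filterlim t at_top sequentially \<and>
           (\<lambda>n. S (t n) x) \<longlonglongrightarrow> y}"

definition dual_repeller ::
    "(real \<Rightarrow> 'a::metric_space \<Rightarrow> 'a) \<Rightarrow> 'a set \<Rightarrow> 'a set \<Rightarrow> 'a set" where
  "dual_repeller S \<A> A = {x\<in>\<A>. omega_limit S x \<inter> A = {}}"

text \<open>Only the values of \<open>M\<close> on \<open>{1..l}\<close> matter.\<close>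

definition morse_decomposition ::
    "(real \<Rightarrow> 'a::metric_space \<Rightarrow> 'a) \<Rightarrow> 'a set \<Rightarrow> nat \<Rightarrow> (nat \<Rightarrow> 'a set) \<Rightarrow> bool" where
  "morse_decomposition S \<A> l M \<longleftrightarrow>
     (\<exists>A :: nat \<Rightarrow> 'a set.
        A 0 = {} \<and> A l = \<A> \<and>
        (\<forall>k\<le>l. attractor_in \<A> S (A k)) \<and>
        (\<forall>k<l. A k \<subset> A (Suc k)) \<and>
        (\<forall>k\<in>{1..l}. M k = A k \<inter> dual_repeller S \<A> (A (k - 1))))"

section \<open>Morse-Lyapunov functions and critical groups\<close>

definition morse_lyapunov ::
    "(real \<Rightarrow> 'a::metric_space \<Rightarrow> 'a) \<Rightarrow> 'a set \<Rightarrow> nat \<Rightarrow> (nat \<Rightarrow> 'a set) \<Rightarrow> ('a \<Rightarrow> real) \<Rightarrow> bool" where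
  "morse_lyapunov S \<Omega> l M V \<longleftrightarrow>
     continuous_on \<Omega> V \<and>
     (\<forall>k\<in>{1..l}. V constant_on M k) \<and>
     (\<forall>x\<in>\<Omega> - (\<Union>k\<in>{1..l}. M k). strict_antimono_on {0..} (\<lambda>t. V (S t x)))"

text \<open>The constant value of \<open>V\<close> on a Morse set (Morse sets are nonempty).\<close>

definition crit_value :: "('a \<Rightarrow> real) \<Rightarrow> 'a set \<Rightarrow> real" where
  "crit_value V N = the_elem (V ` N)"

definition strict_morse_lyapunov ::
    "(real \<Rightarrow> 'a::metric_space \<Rightarrow> 'a) \<Rightarrow> 'a set \<Rightarrow> nat \<Rightarrow> (nat \<Rightarrow> 'a set) \<Rightarrow> ('a \<Rightarrow> real) \<Rightarrow> bool" where
  "strict_morse_lyapunov S \<Omega> l M V \<longleftrightarrow>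
     morse_lyapunov S \<Omega> l M V \<and> strict_mono_on {1..l} (\<lambda>k. crit_value V (M k))"

definition sublevel :: "'a set \<Rightarrow> ('a \<Rightarrow> real) \<Rightarrow> real \<Rightarrow> 'a set" where
  "sublevel \<Omega> V a = {x\<in>\<Omega>. V x \<le> a}"

text \<open>The critical groups of \<open>M k\<close> are only determined up to isomorphism: they may be computed from
  any strict Morse-Lyapunov function \<open>W\<close> and any admissible levels \<open>a'\<close>, \<open>b'\<close>. The predicate says
  that \<open>C\<close> is the sequence of groups obtained from one such choice.\<close>

definition critical_groups ::
    "(real \<Rightarrow> 'a::metric_space \<Rightarrow> 'a) \<Rightarrow> 'a set \<Rightarrow> nat \<Rightarrow> (nat \<Rightarrow> 'a set) \<Rightarrow> nat \<Rightarrow>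
     (nat \<Rightarrow> ('a, 'g::ab_group_add) gchain set monoid) \<Rightarrow> bool" where
  "critical_groups S \<Omega> l M k C \<longleftrightarrow>
     (\<exists>W a' b'.
        strict_morse_lyapunov S \<Omega> l M W \<and>
        a' < crit_value W (M k) \<and> crit_value W (M k) < b' \<and>
        (\<lambda>j. crit_value W (M j)) ` {1..l} \<inter> {a'..b'} = {crit_value W (M k)} \<and>
        C = (\<lambda>q. coeff_relhomology q (top_of_set (sublevel \<Omega> W b')) (sublevel \<Omega> W a')))"

end

theory Submission
  imports Defs
begin

text \<open>
  Let \<open>U\<^sub>k\<close> be the set of points of the basin whose \<open>\<omega>\<close>-limit set meets \<open>M\<^sub>1 \<union> \<dots> \<union> M\<^sub>k\<close>. For every
  strict Morse-Lyapunov function \<open>W\<close> and every level \<open>c\<close> strictly between the \<open>k\<close>-th and the next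
  generalized critical value, \<open>U\<^sub>k\<close> consists of the points whose orbit reaches \<open>{W < c}\<close>, hence the
  semiflow carries each compact subset of \<open>U\<^sub>k\<close> into \<open>W\<^sub>c\<close> in finite time. Since chains have compact
  support, \<open>H\<^sub>*(W\<^sub>b, W\<^sub>a)\<close> is isomorphic to \<open>H\<^sub>*(U\<^sub>k, U\<^sub>i)\<close>, which no longer involves \<open>W\<close>; this makes the
  critical groups independent of all choices without any deformation of sublevel sets. Counting
  ranks in the exact sequences of the triples \<open>(U\<^bsub>k+1\<^esub>, U\<^sub>k, \<emptyset>)\<close> gives \<open>m\<^sub>q = \<beta>\<^sub>q + D\<^sub>q + D\<^bsub>q+1\<^esub>\<close> with
  \<open>D\<^sub>0 = 0\<close>, where \<open>D\<close> collects the ranks of the connecting homomorphisms.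
\<close>

section \<open>Ranks of quotients of abelian groups\<close>

text \<open>The obstacle is that a critical group may be computed from another function
  \<open>W\<close> and other levels than those of \<open>V\<close>, while a semiflow cannot be run
  backwards to compare two sublevel sets. Sets defined by limit sets alone give a common target. The
  inclusion of a sublevel pair into the corresponding pair of such sets has the semiflow itself as
  inverse, one chain at a time: the absorbing time may depend on the chain.

  Rank means rank over \<int>, that is, dimension after tensoring with the rationals. Torsion does
  not count, which is why rank is additive along subgroups for every coefficient group.

  Ranks are kept in \<open>enat\<close> and the identity with the connecting ranks contains no
  subtraction, so it is available before any finiteness is known; finiteness of its left side then
  bounds every term on the right. Taking alternating sums leaves the single defect
  \<open>D (Suc q)\<close>, which is nonnegative. Convergence of the series of the
  \<open>m q\<close> makes these natural numbers vanish eventually, and the defect with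
  them.\<close>

definition additive_group :: "'c::ab_group_add monoid" where
  "additive_group = \<lparr>carrier = UNIV, monoid.mult = (+), one = 0\<rparr>"

lemma additive_group_simps [simp]:
  "carrier additive_group = UNIV" "x \<otimes>\<^bsub>additive_group\<^esub> y = x + y" "\<one>\<^bsub>additive_group\<^esub> = 0"
  by (simp_all add: additive_group_def)

lemma comm_group_additive_group: "comm_group (additive_group :: 'c::ab_group_add monoid)"
  by (rule comm_groupI) (auto simp: algebra_simps intro: exI[of _ "- x" for x])

interpretation additive_group: comm_group "additive_group :: 'c::ab_group_add monoid"
  by (rule comm_group_additive_group)

text \<open>Integer multiples are borrowed from integer powers in the additive group, so the module
  laws over \<int> become the power laws of an abelian group.\<close>

definition zmul :: "int \<Rightarrow> 'c::ab_group_add \<Rightarrow> 'c" where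
  "zmul k x = x [^]\<^bsub>additive_group\<^esub> k"

lemma zmul_0 [simp]: "zmul 0 x = 0" and zmul_1 [simp]: "zmul 1 x = x"
  and zmul_zero [simp]: "zmul k 0 = 0"
  using additive_group.int_pow_one[of k] by (simp_all add: zmul_def additive_group.int_pow_1)

lemma zmul_add_left: "zmul (j + k) x = zmul j x + zmul k x"
  using additive_group.int_pow_mult[of x j k] by (simp add: zmul_def)

lemma zmul_add_right: "zmul k (x + y) = zmul k x + zmul k y"
  using additive_group.int_pow_distrib[of x y k] by (simp add: zmul_def)

lemma zmul_zmul: "zmul j (zmul k x) = zmul (j * k) x"
  using additive_group.int_pow_pow[of x k j] by (simp add: zmul_def mult.commute)

lemma zmul_minus_left: "zmul (- k) x = - zmul k x"
  using zmul_add_left[of "-k" k x] by (simp add: eq_neg_iff_add_eq_0)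

lemma zmul_minus_right: "zmul k (- x) = - zmul k x"
  using zmul_add_right[of k "-x" x] by (simp add: eq_neg_iff_add_eq_0)

lemma zmul_sum_right: "zmul k (sum f I) = (\<Sum>i\<in>I. zmul k (f i))"
  by (induction I rule: infinite_finite_induct) (auto simp: zmul_add_right)

lemma zmul_sum_left: "zmul (sum f I) x = (\<Sum>i\<in>I. zmul (f i) x)"
  by (induction I rule: infinite_finite_induct) (auto simp: zmul_add_left)

lemma additive_zmul:
  assumes "Modules.additive f"
  shows "f (zmul k x) = zmul k (f x)"
proof -
  interpret Modules.additive f by fact
  show ?thesis
  proof (induction k rule: int_induct[where k=0])
    case base show ?case by (simp add: zero)
  next
    case (step1 i) then show ?case by (simp add: zmul_add_left add)
  next
    case (step2 i)
    have "f (zmul (i - 1) x) = f (zmul i x) - f x"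
      using zmul_add_left[of "i - 1" 1 x] add[of "zmul (i - 1) x" x] by simp
    also have "\<dots> = zmul (i - 1) (f x)"
      using step2 zmul_add_left[of "i - 1" 1 "f x"] by simp
    finally show ?case .
  qed
qed

lemma additive_sum_zmul:
  assumes "Modules.additive f"
  shows "f (\<Sum>i\<in>I. zmul (k i) (v i)) = (\<Sum>i\<in>I. zmul (k i) (f (v i)))"
  by (simp add: Modules.additive.sum[OF assms] additive_zmul[OF assms])

section \<open>Subgroups of an additive type and ranks of their quotients\<close>

definition add_subgroup :: "'c::ab_group_add set \<Rightarrow> bool" where
  "add_subgroup Z \<longleftrightarrow> 0 \<in> Z \<and> (\<forall>x\<in>Z. \<forall>y\<in>Z. x - y \<in> Z)"

lemma add_subgroupD:
  assumes "add_subgroup Z"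
  shows add_subgroup_0: "0 \<in> Z"
    and add_subgroup_diff: "\<And>x y. x \<in> Z \<Longrightarrow> y \<in> Z \<Longrightarrow> x - y \<in> Z"
    and add_subgroup_uminus: "\<And>x. x \<in> Z \<Longrightarrow> - x \<in> Z"
    and add_subgroup_add: "\<And>x y. x \<in> Z \<Longrightarrow> y \<in> Z \<Longrightarrow> x + y \<in> Z"
proof -
  show 0: "0 \<in> Z" and d: "x \<in> Z \<Longrightarrow> y \<in> Z \<Longrightarrow> x - y \<in> Z" for x y
    using assms by (auto simp: add_subgroup_def)
  show m: "x \<in> Z \<Longrightarrow> - x \<in> Z" for x using d[OF 0] by simp
  show "x \<in> Z \<Longrightarrow> y \<in> Z \<Longrightarrow> x + y \<in> Z" for x y using d[of x "-y"] m by simp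
qed

lemma add_subgroup_zmul:
  assumes "add_subgroup Z" "x \<in> Z"
  shows "zmul k x \<in> Z"
proof (induction k rule: int_induct[where k=0])
  case base then show ?case using assms by (simp add: add_subgroup_0)
next
  case (step1 i) then show ?case using assms by (simp add: zmul_add_left add_subgroup_add)
next
  case (step2 i)
  have "zmul (i - 1) x = zmul i x - x"
    using zmul_add_left[of "i - 1" 1 x] by simp
  then show ?case using step2 assms by (simp add: add_subgroup_diff)
qed

lemma add_subgroup_sum:
  assumes "add_subgroup Z" "\<And>i. i \<in> I \<Longrightarrow> f i \<in> Z"
  shows "sum f I \<in> Z"
  using assms(2) by (induction I rule: infinite_finite_induct)
    (auto intro: add_subgroup_0[OF assms(1)] add_subgroup_add[OF assms(1)])

text \<open>This is \<int>-independence of the classes of \<open>v 0\<close>, ...,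
  \<open>v (n - 1)\<close> modulo \<open>B\<close>, phrased on representatives so that no cosets are
  formed. Indexed families can be mapped and concatenated without checking that their members stay
  distinct.\<close>

definition indep_mod :: "'c::ab_group_add set \<Rightarrow> nat \<Rightarrow> (nat \<Rightarrow> 'c) \<Rightarrow> bool" where
  "indep_mod B n v \<longleftrightarrow> (\<forall>k. (\<Sum>i<n. zmul (k i) (v i)) \<in> B \<longrightarrow> (\<forall>i<n. k i = 0))"

definition quotient_rank :: "'c::ab_group_add set \<Rightarrow> 'c set \<Rightarrow> enat" where
  "quotient_rank Z B = (SUP n\<in>{n. \<exists>v. v ` {..<n} \<subseteq> Z \<and> indep_mod B n v}. enat n)"

lemma indep_mod_mono:
  assumes "indep_mod B n v" "m \<le> n"
  shows "indep_mod B m v"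
  unfolding indep_mod_def
proof safe
  fix k i assume k: "(\<Sum>i<m. zmul (k i) (v i)) \<in> B" and i: "i < m"
  have "(\<Sum>i<n. zmul (if i < m then k i else 0) (v i)) = (\<Sum>i<m. zmul (k i) (v i))"
    using assms(2) by (intro sum.mono_neutral_cong_right) auto
  with k have "(\<Sum>i<n. zmul (if i < m then k i else 0) (v i)) \<in> B" by simp
  then have "\<forall>i<n. (if i < m then k i else 0) = 0"
    using spec[OF assms(1)[unfolded indep_mod_def], of "\<lambda>i. if i < m then k i else 0"] by simp
  then have "(if i < m then k i else 0) = 0" using i assms(2) less_le_trans by blast
  then show "k i = 0" using i by simp
qed

text \<open>If \<open>m + 1\<close> lies below the supremum, some member exceeds \<open>m\<close>,
  and downward closure yields \<open>m + 1\<close> itself. Finite lower bounds are thus attained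
  even when the supremum is \<infinity>.\<close>

lemma enat_le_SUP_enat_iff:
  assumes "\<And>m n. n \<in> N \<Longrightarrow> m \<le> n \<Longrightarrow> m \<in> N" "0 \<in> N"
  shows "enat n \<le> (SUP n\<in>N. enat n) \<longleftrightarrow> n \<in> N"
proof
  assume n: "enat n \<le> (SUP n\<in>N. enat n)"
  show "n \<in> N"
  proof (cases n)
    case (Suc m)
    then have "enat m < (SUP n\<in>N. enat n)"
      using n by (metis Suc_ile_eq)
    then obtain k where "k \<in> N" "m < k" by (auto simp: less_SUP_iff)
    then show ?thesis using assms(1)[of k n] Suc by simp
  qed (use assms in simp)
qed (simp add: SUP_upper)

lemma enat_le_quotient_rank_iff:
  "enat n \<le> quotient_rank Z B \<longleftrightarrow> (\<exists>v. v ` {..<n} \<subseteq> Z \<and> indep_mod B n v)"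
proof -
  have "m \<in> {n. \<exists>v. v ` {..<n} \<subseteq> Z \<and> indep_mod B n v}"
    if "n \<in> {n. \<exists>v. v ` {..<n} \<subseteq> Z \<and> indep_mod B n v}" "m \<le> n" for m n
    using that indep_mod_mono by (force simp: image_subset_iff)
  moreover have "0 \<in> {n. \<exists>v. v ` {..<n} \<subseteq> Z \<and> indep_mod B n v}"
    by (auto simp: indep_mod_def)
  ultimately show ?thesis
    unfolding quotient_rank_def by (subst enat_le_SUP_enat_iff) auto
qed

lemma enat_le_via_nat:
  assumes "\<And>n. enat n \<le> x \<Longrightarrow> enat n \<le> y"
  shows "x \<le> y"
proof (cases y)
  case (enat m)
  then have "\<not> enat (Suc m) \<le> x" using assms[of "Suc m"] by auto
  then show ?thesis using enat by (simp add: Suc_ile_eq not_less)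
qed simp

text \<open>A finite lower bound of a sum splits into finite lower bounds of the summands.
  Inequalities between possibly infinite ranks then reduce to constructing finite families.\<close>

lemma enat_add_le_via_nat:
  assumes "\<And>m n. enat m \<le> x \<Longrightarrow> enat n \<le> y \<Longrightarrow> enat (m + n) \<le> z"
  shows "x + y \<le> z"
proof (rule enat_le_via_nat)
  fix n assume n: "enat n \<le> x + y"
  have "\<exists>a b. enat a \<le> x \<and> enat b \<le> y \<and> n = a + b"
  proof (cases x)
    case infinity
    then show ?thesis by (intro exI[of _ n] exI[of _ 0]) (simp add: zero_enat_def[symmetric])
  next
    case x: (enat x')
    show ?thesis
    proof (cases y)
      case infinity
      then show ?thesis by (intro exI[of _ 0] exI[of _ n]) (simp add: zero_enat_def[symmetric])
    next
      case (enat y')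
      then show ?thesis using n x
        by (intro exI[of _ "min n x'"] exI[of _ "n - min n x'"]) auto
    qed
  qed
  then show "enat n \<le> z" using assms by blast
qed

text \<open>Only elements of \<open>B\<close> are sent from \<open>Z\<close> into \<open>B'\<close>,
  so a relation among the images pulls back and an independent family stays independent.\<close>

lemma quotient_rank_le_of_map:
  fixes f :: "'c::ab_group_add \<Rightarrow> 'd::ab_group_add"
  assumes "\<And>x y. f (x + y) = f x + f y"
    and "f ` Z \<subseteq> Z'" "\<And>z. z \<in> Z \<Longrightarrow> f z \<in> B' \<Longrightarrow> z \<in> B" "add_subgroup Z"
  shows "quotient_rank Z B \<le> quotient_rank Z' B'"
proof (rule enat_le_via_nat)
  fix n assume "enat n \<le> quotient_rank Z B"
  then obtain v where v: "v ` {..<n} \<subseteq> Z" "indep_mod B n v"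
    by (auto simp: enat_le_quotient_rank_iff)
  note fs = additive_sum_zmul[of f, OF Modules.additive.intro[OF assms(1)]]
  have "indep_mod B' n (f \<circ> v)"
    unfolding indep_mod_def
  proof (intro allI impI)
    fix k i assume k: "(\<Sum>i<n. zmul (k i) ((f \<circ> v) i)) \<in> B'" "i < n"
    have "(\<Sum>i<n. zmul (k i) (v i)) \<in> Z"
      using v by (intro add_subgroup_sum add_subgroup_zmul assms(4)) auto
    then have "(\<Sum>i<n. zmul (k i) (v i)) \<in> B" using k assms(3) by (simp add: fs)
    then show "k i = 0" using v k by (auto simp: indep_mod_def)
  qed
  moreover have "(f \<circ> v) ` {..<n} \<subseteq> Z'" using v assms(2) by auto
  ultimately show "enat n \<le> quotient_rank Z' B'"
    unfolding enat_le_quotient_rank_iff by blast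
qed

text \<open>Surjectivity modulo \<open>B'\<close> lifts an independent family up to errors in
  \<open>B'\<close>. A relation among the lifts modulo \<open>B\<close> maps to a relation in the
  original family modulo \<open>B'\<close>.\<close>

lemma quotient_rank_ge_of_map:
  fixes f :: "'c::ab_group_add \<Rightarrow> 'd::ab_group_add"
  assumes "\<And>x y. f (x + y) = f x + f y"
    and "\<And>z. z \<in> B \<Longrightarrow> f z \<in> B'"
    and "\<And>z'. z' \<in> Z' \<Longrightarrow> \<exists>z\<in>Z. f z - z' \<in> B'" "add_subgroup B'"
  shows "quotient_rank Z' B' \<le> quotient_rank Z B"
proof (rule enat_le_via_nat)
  fix n assume "enat n \<le> quotient_rank Z' B'"
  then obtain v where v: "v ` {..<n} \<subseteq> Z'" "indep_mod B' n v"
    by (auto simp: enat_le_quotient_rank_iff)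
  have "\<forall>i. \<exists>u. i < n \<longrightarrow> u \<in> Z \<and> f u - v i \<in> B'" using v assms(3) by blast
  then obtain u where u: "\<And>i. i < n \<Longrightarrow> u i \<in> Z \<and> f (u i) - v i \<in> B'" by metis
  note fs = additive_sum_zmul[of f, OF Modules.additive.intro[OF assms(1)]]
  have "indep_mod B n u"
    unfolding indep_mod_def
  proof (intro allI impI)
    fix k i assume k: "(\<Sum>i<n. zmul (k i) (u i)) \<in> B" "i < n"
    then have "(\<Sum>i<n. zmul (k i) (f (u i))) \<in> B'" using assms(2) fs by metis
    moreover have "(\<Sum>i<n. zmul (k i) (f (u i) - v i)) \<in> B'"
      using u by (intro add_subgroup_sum add_subgroup_zmul assms(4)) auto
    moreover have "(\<Sum>i<n. zmul (k i) (v i)) = (\<Sum>i<n. zmul (k i) (f (u i))) - (\<Sum>i<n. zmul (k i) (f (u i) - v i))"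
      by (simp add: diff_conv_add_uminus zmul_add_right zmul_minus_right sum.distrib sum_negf del: add_uminus_conv_diff)
    ultimately have "(\<Sum>i<n. zmul (k i) (v i)) \<in> B'" using add_subgroup_diff[OF assms(4)] by metis
    then show "k i = 0" using v k by (auto simp: indep_mod_def)
  qed
  then show "enat n \<le> quotient_rank Z B"
    unfolding enat_le_quotient_rank_iff using u by blast
qed

lemma quotient_rank_eq_of_map:
  fixes f :: "'c::ab_group_add \<Rightarrow> 'd::ab_group_add"
  assumes "\<And>x y. f (x + y) = f x + f y" "add_subgroup Z" "add_subgroup B'" "B \<subseteq> Z"
    and "\<And>z. z \<in> Z \<Longrightarrow> f z \<in> Z'" "\<And>z. z \<in> Z \<Longrightarrow> f z \<in> B' \<longleftrightarrow> z \<in> B"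
    and "\<And>z'. z' \<in> Z' \<Longrightarrow> \<exists>z\<in>Z. f z - z' \<in> B'"
  shows "quotient_rank Z B = quotient_rank Z' B'"
  by (rule antisym[OF quotient_rank_le_of_map[of f] quotient_rank_ge_of_map[of f]]) (use assms in auto)

text \<open>Gaussian elimination without fractions: with a pivot row \<open>p\<close>,
  cross-multiplication clears column \<open>m\<close> from the other rows and keeps all entries
  integral.\<close>

lemma integer_relation:
  fixes a :: "'i \<Rightarrow> nat \<Rightarrow> int"
  assumes "finite I" "m < card I"
  shows "\<exists>k. (\<exists>i\<in>I. k i \<noteq> 0) \<and> (\<forall>j<m. (\<Sum>i\<in>I. k i * a i j) = 0)"
  using assms
proof (induction m arbitrary: I a)
  case 0
  then have "I \<noteq> {}" by auto
  then show ?case by (intro exI[of _ "\<lambda>_. 1"]) auto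
next
  case (Suc m)
  show ?case
  proof (cases "\<forall>i\<in>I. a i m = 0")
    case True
    obtain k where "\<exists>i\<in>I. k i \<noteq> 0" "\<forall>j<m. (\<Sum>i\<in>I. k i * a i j) = 0"
      using Suc.IH[of I a] Suc.prems by auto
    then show ?thesis using True by (intro exI[of _ k]) (auto simp: less_Suc_eq)
  next
    case False
    then obtain p where p: "p \<in> I" "a p m \<noteq> 0" by blast
    let ?J = "I - {p}"
    obtain k where k: "\<exists>i\<in>?J. k i \<noteq> 0"
        "\<forall>j<m. (\<Sum>i\<in>?J. k i * (a p m * a i j - a i m * a p j)) = 0"
      using Suc.IH[of ?J "\<lambda>i j. a p m * a i j - a i m * a p j"] Suc.prems p
      by (auto simp: less_diff_conv)
    \<comment> \<open>Row \<open>p\<close> receives all multiples that the elimination subtracted.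
      With this choice the combination of the original rows equals that of the eliminated ones in
      every column, and column \<open>m\<close> vanishes identically.\<close>
    define k' where "k' i = (if i = p then - (\<Sum>i\<in>?J. k i * a i m) else a p m * k i)" for i
    have "(\<Sum>i\<in>I. k' i * a i j) = (\<Sum>i\<in>?J. k i * (a p m * a i j - a i m * a p j))" for j
    proof -
      have "(\<Sum>i\<in>I. k' i * a i j) = k' p * a p j + (\<Sum>i\<in>?J. k' i * a i j)"
        using Suc.prems p by (simp add: sum.remove)
      also have "(\<Sum>i\<in>?J. k' i * a i j) = (\<Sum>i\<in>?J. a p m * k i * a i j)"
        by (intro sum.cong) (auto simp: k'_def)
      finally show ?thesis
        by (simp add: k'_def algebra_simps sum_subtractf sum_distrib_left sum_distrib_right)
    qed
    then have "\<forall>j<Suc m. (\<Sum>i\<in>I. k' i * a i j) = 0"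
      using k(2) by (auto simp: less_Suc_eq mult.commute)
    moreover have "\<exists>i\<in>I. k' i \<noteq> 0" using k(1) p by (auto simp: k'_def)
    ultimately show ?thesis by blast
  qed
qed

text \<open>A maximal independent family spans up to torsion: adjoining \<open>v\<close> creates a
  relation, and its coefficient at \<open>v\<close> is nonzero because the family alone is
  independent.\<close>

lemma quotient_rank_spanning:
  assumes "quotient_rank Z B = enat r"
  obtains u where "u ` {..<r} \<subseteq> Z"
    "\<And>v. v \<in> Z \<Longrightarrow> \<exists>N a. N \<noteq> 0 \<and> zmul N v + (\<Sum>j<r. zmul (a j) (u j)) \<in> B"
proof -
  obtain u where u: "u ` {..<r} \<subseteq> Z" "indep_mod B r u"
    using enat_le_quotient_rank_iff[of r Z B] assms by auto
  have "\<exists>N a. N \<noteq> 0 \<and> zmul N v + (\<Sum>j<r. zmul (a j) (u j)) \<in> B" if v: "v \<in> Z" for v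
  proof -
    let ?w = "u(r := v)"
    have "\<not> enat (Suc r) \<le> quotient_rank Z B" by (simp add: assms)
    moreover have "?w ` {..<Suc r} \<subseteq> Z" using u v by (auto simp: less_Suc_eq)
    ultimately have "\<not> indep_mod B (Suc r) ?w"
      unfolding enat_le_quotient_rank_iff by blast
    then obtain k i where k: "(\<Sum>i<Suc r. zmul (k i) (?w i)) \<in> B" "i < Suc r" "k i \<noteq> 0"
      by (auto simp: indep_mod_def)
    have s: "(\<Sum>i<Suc r. zmul (k i) (?w i)) = zmul (k r) v + (\<Sum>i<r. zmul (k i) (u i))"
      by (simp add: add.commute)
    have "k r \<noteq> 0"
    proof
      assume "k r = 0"
      with s k(1) u(2) have "\<forall>i<r. k i = 0" by (simp add: indep_mod_def)
      with k \<open>k r = 0\<close> show False by (auto simp: less_Suc_eq)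
    qed
    then show ?thesis using s k(1) by (intro exI[of _ "k r"] exI[of _ k]) (simp add: add.commute)
  qed
  then show ?thesis using that u by blast
qed

lemma sum_shift_split:
  fixes f :: "nat \<Rightarrow> 'c::ab_group_add"
  shows "(\<Sum>i<r+s. f i) = (\<Sum>i<r. f i) + (\<Sum>i<s. f (r + i))"
  by (induction s) (simp_all add: add.assoc)

text \<open>A family independent modulo \<open>Y\<close> is followed by one inside \<open>Y\<close>
  independent modulo \<open>B\<close>. A relation read modulo \<open>Y\<close> kills the first block
  of coefficients, and what remains kills the second.\<close>

lemma quotient_rank_superadditive:
  assumes Z: "Y \<subseteq> Z" "B \<subseteq> Y" and Y: "add_subgroup Y"
  shows "quotient_rank Z Y + quotient_rank Y B \<le> quotient_rank Z B"
proof -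
  have *: "enat (n + m) \<le> quotient_rank Z B"
    if n: "enat n \<le> quotient_rank Z Y" and m: "enat m \<le> quotient_rank Y B" for n m
  proof -
    obtain v w where v: "v ` {..<n} \<subseteq> Z" "indep_mod Y n v" and w: "w ` {..<m} \<subseteq> Y" "indep_mod B m w"
      using n m by (auto simp: enat_le_quotient_rank_iff)
    define u where "u i = (if i < n then v i else w (i - n))" for i
    have "indep_mod B (n + m) u"
      unfolding indep_mod_def
    proof (intro allI impI)
      fix k i assume k: "(\<Sum>i<n+m. zmul (k i) (u i)) \<in> B" and i: "i < n + m"
      have s: "(\<Sum>i<n+m. zmul (k i) (u i)) = (\<Sum>i<n. zmul (k i) (v i)) + (\<Sum>i<m. zmul (k (n + i)) (w i))"
        by (simp add: sum_shift_split u_def)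
      have "(\<Sum>i<m. zmul (k (n + i)) (w i)) \<in> Y"
        using w by (intro add_subgroup_sum add_subgroup_zmul Y) auto
      with s k Z(2) have "(\<Sum>i<n. zmul (k i) (v i)) \<in> Y"
        using add_subgroup_diff[OF Y] by (metis add_diff_cancel_right' subsetD)
      with v have kn: "\<forall>i<n. k i = 0" by (simp add: indep_mod_def)
      with s k have "(\<Sum>i<m. zmul (k (n + i)) (w i)) \<in> B" by simp
      with w have "\<forall>i<m. k (n + i) = 0" by (auto simp: indep_mod_def)
      with kn i show "k i = 0" by (metis add_less_cancel_left le_add_diff_inverse not_less)
    qed
    moreover have "u ` {..<n+m} \<subseteq> Z"
    proof -
      have "u i \<in> Z" if "i < n + m" for i
        using that v(1) w(1) Z(1) by (cases "i < n") (force simp: u_def image_subset_iff)+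
      then show ?thesis by auto
    qed
    ultimately show ?thesis unfolding enat_le_quotient_rank_iff by blast
  qed
  then show ?thesis by (rule enat_add_le_via_nat)
qed

text \<open>If both ranks on the right are finite, their spanning families together span
  \<open>Z\<close> modulo \<open>B\<close> up to torsion with \<open>r + s\<close> elements, so
  \<open>r + s + 1\<close> independent elements cannot exist.\<close>

lemma quotient_rank_subadditive:
  assumes "add_subgroup B"
  shows "quotient_rank Z B \<le> quotient_rank Z Y + quotient_rank Y B"
proof (cases "quotient_rank Z Y"; cases "quotient_rank Y B")
  fix r s assume r: "quotient_rank Z Y = enat r" and s: "quotient_rank Y B = enat s"
  show ?thesis
  proof (rule ccontr)
    assume "\<not> ?thesis"
    then have "enat (Suc (r + s)) \<le> quotient_rank Z B"
      by (simp add: r s Suc_ile_eq not_le)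
    then obtain v where v: "v ` {..<Suc (r+s)} \<subseteq> Z" "indep_mod B (Suc (r+s)) v"
      by (auto simp only: enat_le_quotient_rank_iff)
    obtain z where z: "\<And>v. v \<in> Z \<Longrightarrow> \<exists>N a. N \<noteq> 0 \<and> zmul N v + (\<Sum>j<r. zmul (a j) (z j)) \<in> Y"
      using quotient_rank_spanning[OF r] by metis
    obtain y where y: "\<And>v. v \<in> Y \<Longrightarrow> \<exists>N a. N \<noteq> 0 \<and> zmul N v + (\<Sum>j<s. zmul (a j) (y j)) \<in> B"
      using quotient_rank_spanning[OF s] by metis
    define w where "w j = (if j < r then z j else y (j - r))" for j
    have "\<exists>N a. N \<noteq> 0 \<and> zmul N x + (\<Sum>j<r+s. zmul (a j) (w j)) \<in> B" if x: "x \<in> Z" for x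
    proof -
      obtain N a where 1: "N \<noteq> 0" "zmul N x + (\<Sum>j<r. zmul (a j) (z j)) \<in> Y" using z[OF x] by blast
      obtain N' a' where 2: "N' \<noteq> 0"
        "zmul N' (zmul N x + (\<Sum>j<r. zmul (a j) (z j))) + (\<Sum>j<s. zmul (a' j) (y j)) \<in> B"
        using y[OF 1(2)] by blast
      define c where "c j = (if j < r then N' * a j else a' (j - r))" for j
      have "zmul (N' * N) x + (\<Sum>j<r+s. zmul (c j) (w j))
          = zmul N' (zmul N x + (\<Sum>j<r. zmul (a j) (z j))) + (\<Sum>j<s. zmul (a' j) (y j))"
        by (simp add: sum_shift_split c_def w_def zmul_add_right zmul_zmul zmul_sum_right add.assoc)
      then show ?thesis using 1 2 by (intro exI[of _ "N' * N"] exI[of _ c]) simp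
    qed
    then have "\<forall>i. \<exists>N a. i < Suc (r+s) \<longrightarrow> N \<noteq> 0 \<and> zmul N (v i) + (\<Sum>j<r+s. zmul (a j) (w j)) \<in> B"
      using v(1) by (metis imageI lessThan_iff subsetD)
    then obtain N a where Na: "\<And>i. i < Suc (r+s) \<Longrightarrow>
        N i \<noteq> 0 \<and> zmul (N i) (v i) + (\<Sum>j<r+s. zmul (a i j) (w j)) \<in> B"
      by metis
    \<comment> \<open>This relation cancels the contribution of every spanning element. The relation
      left among the \<open>v i\<close> has coefficients \<open>k i * N i\<close>, not all zero
      since each \<open>N i\<close> is nonzero.\<close>
    obtain k where k: "\<exists>i<Suc (r+s). k i \<noteq> 0" "\<forall>j<r+s. (\<Sum>i<Suc (r+s). k i * a i j) = 0"
      using integer_relation[of "{..<Suc (r+s)}" "r+s" a] by auto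
    let ?n = "Suc (r + s)"
    have "(\<Sum>i<?n. zmul (k i) (zmul (N i) (v i) + (\<Sum>j<r+s. zmul (a i j) (w j)))) \<in> B"
      by (intro add_subgroup_sum add_subgroup_zmul assms) (use Na in auto)
    also have "(\<Sum>i<?n. zmul (k i) (zmul (N i) (v i) + (\<Sum>j<r+s. zmul (a i j) (w j))))
       = (\<Sum>i<?n. zmul (k i * N i) (v i)) + (\<Sum>i<?n. \<Sum>j<r+s. zmul (k i * a i j) (w j))"
      by (simp only: zmul_add_right zmul_zmul sum.distrib zmul_sum_right)
    also have "(\<Sum>i<?n. \<Sum>j<r+s. zmul (k i * a i j) (w j)) = (\<Sum>j<r+s. zmul (\<Sum>i<?n. k i * a i j) (w j))"
      by (subst sum.swap) (simp only: zmul_sum_left)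
    also have "\<dots> = 0" using k(2) by (simp del: sum.lessThan_Suc)
    finally have "(\<Sum>i<?n. zmul (k i * N i) (v i)) \<in> B" by simp
    then have "\<forall>i<?n. k i * N i = 0"
      using spec[OF v(2)[unfolded indep_mod_def], of "\<lambda>i. k i * N i"] by (simp del: sum.lessThan_Suc)
    then show False using k(1) Na by auto
  qed
qed auto

lemma quotient_rank_additive:
  assumes "Y \<subseteq> Z" "B \<subseteq> Y" "add_subgroup Y" "add_subgroup B"
  shows "quotient_rank Z B = quotient_rank Z Y + quotient_rank Y B"
  using assms by (intro antisym quotient_rank_subadditive quotient_rank_superadditive)

lemma quotient_rank_self:
  assumes "add_subgroup B"
  shows "quotient_rank B B = 0"
proof (rule ccontr)
  assume "quotient_rank B B \<noteq> 0"
  then have "enat (Suc 0) \<le> quotient_rank B B"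
    by (cases "quotient_rank B B") (auto simp: zero_enat_def)
  then obtain v where v: "v ` {..<Suc 0} \<subseteq> B" "indep_mod B (Suc 0) v"
    unfolding enat_le_quotient_rank_iff by blast
  then have "(\<Sum>i<Suc 0. zmul 1 (v i)) \<in> B" by (auto simp: image_subset_iff)
  then have "\<forall>i<Suc 0. (1::int) = 0" using spec[OF v(2)[unfolded indep_mod_def], of "\<lambda>_. 1"] by simp
  then show False by (metis lessI zero_neq_one)
qed

section \<open>Comparison with the rank of a quotient monoid\<close>

lemma enat_le_ab_rank_iff:
  "enat n \<le> ab_rank G \<longleftrightarrow> (\<exists>D. Z_independent G D \<and> card D = n)" if "comm_group G"
proof -
  interpret comm_group G by fact
  have "m \<in> card ` Collect (Z_independent G)"
    if n: "n \<in> card ` Collect (Z_independent G)" and m: "m \<le> n" for m n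
  proof -
    obtain D where D: "Z_independent G D" "card D = n" using n by auto
    then obtain E where E: "E \<subseteq> D" "card E = m" "finite E"
      using m obtain_subset_with_card_n by metis
    have "Z_independent G E"
      unfolding Z_independent_def
    proof (intro conjI allI impI ballI)
      show "finite E" "E \<subseteq> carrier G" using D E by (auto simp: Z_independent_def)
      fix k :: "_ \<Rightarrow> int" and x
      assume k: "finprod G (\<lambda>x. x [^]\<^bsub>G\<^esub> k x) E = \<one>\<^bsub>G\<^esub>" and x: "x \<in> E"
      let ?k = "\<lambda>x. if x \<in> E then k x else 0"
      have "finprod G (\<lambda>x. x [^]\<^bsub>G\<^esub> ?k x) D = finprod G (\<lambda>x. x [^]\<^bsub>G\<^esub> k x) E"
        using D E by (intro finprod_mono_neutral_cong_right) (auto simp: Z_independent_def)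
      then have "finprod G (\<lambda>x. x [^]\<^bsub>G\<^esub> ?k x) D = \<one>\<^bsub>G\<^esub>" using k by (rule trans)
      then have "\<forall>x\<in>D. ?k x = 0"
        by (rule mp[OF spec[OF D(1)[unfolded Z_independent_def, THEN conjunct2, THEN conjunct2], of ?k]])
      then have "?k x = 0" using x E(1) by blast
      then show "k x = 0" using x by simp
    qed
    then show ?thesis using E by blast
  qed
  moreover have "0 \<in> card ` Collect (Z_independent G)"
    by (rule image_eqI[of _ _ "{}"]) (auto simp: Z_independent_def)
  moreover have "ab_rank G = (SUP n\<in>card ` Collect (Z_independent G). enat n)"
    by (simp add: ab_rank_def image_comp)
  ultimately have "enat n \<le> ab_rank G \<longleftrightarrow> n \<in> card ` Collect (Z_independent G)"
    using enat_le_SUP_enat_iff by metis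
  then show ?thesis by auto
qed

text \<open>The coset map is a homomorphism with kernel \<open>B\<close>, so a product of powers of
  cosets is trivial exactly when the matching integer combination lies in \<open>B\<close>. The rest
  translates between sets of cosets and indexed representatives.\<close>

lemma ab_rank_quotient:
  fixes Z B :: "'c::ab_group_add set"
  assumes Z: "add_subgroup Z" and B: "add_subgroup B" "B \<subseteq> Z"
  shows "ab_rank (\<lparr>carrier = Z, monoid.mult = (+), one = 0\<rparr> Mod B) = quotient_rank Z B"
proof -
  define G :: "'c monoid" where "G = \<lparr>carrier = Z, monoid.mult = (+), one = 0\<rparr>"
  have G [simp]: "carrier G = Z" "x \<otimes>\<^bsub>G\<^esub> y = x + y" "\<one>\<^bsub>G\<^esub> = 0" for x y
    by (simp_all add: G_def)
  interpret G: comm_group G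
  proof (rule comm_groupI)
    show "\<exists>y\<in>carrier G. y \<otimes>\<^bsub>G\<^esub> x = \<one>\<^bsub>G\<^esub>" if "x \<in> carrier G" for x
      using that add_subgroup_uminus[OF Z] by (intro bexI[of _ "-x"]) auto
  qed (use add_subgroup_0[OF Z] add_subgroup_add[OF Z] in \<open>auto simp: algebra_simps\<close>)
  have Ginv: "inv\<^bsub>G\<^esub> x = - x" if "x \<in> Z" for x
    using that add_subgroup_uminus[OF Z] by (intro G.inv_equality) auto
  have subB: "subgroup B G"
    using B add_subgroup_0[OF B(1)] add_subgroup_add[OF B(1)] add_subgroup_uminus[OF B(1)] Ginv
    by (intro G.subgroupI) auto
  have norm: "B \<lhd> G" using G.subgroup_imp_normal[OF subB] .
  interpret N: normal B G by fact
  interpret Q: comm_group "G Mod B" using G.abelian_FactGroup[OF subB] .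
  define \<pi> where "\<pi> x = B #>\<^bsub>G\<^esub> x" for x
  have \<pi>_hom: "\<pi> \<in> hom G (G Mod B)" unfolding \<pi>_def using N.r_coset_hom_Mod .
  interpret \<pi>: group_hom G "G Mod B" \<pi> by unfold_locales (rule \<pi>_hom)
  have \<pi>_one: "\<pi> x = \<one>\<^bsub>G Mod B\<^esub> \<longleftrightarrow> x \<in> B" if "x \<in> Z" for x
    unfolding \<pi>_def FactGroup_def using that subB G.coset_join1[OF _ _ subB] G.coset_join2[OF _ subB]
    by (auto simp: B(2)) 
  have pow: "x [^]\<^bsub>G\<^esub> k = zmul k x" if "x \<in> Z" for x and k :: int
  proof (induction k rule: int_induct[where k=0])
    case base show ?case by simp
  next
    case (step1 i)
    then show ?case using that by (simp add: G.int_pow_mult zmul_add_left)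
  next
    case (step2 i)
    have "x [^]\<^bsub>G\<^esub> (i - 1) + x = x [^]\<^bsub>G\<^esub> i" using that G.int_pow_mult[of x "i - 1" 1] by simp
    moreover have "zmul (i - 1) x + x = zmul i x" using zmul_add_left[of "i - 1" 1 x] by simp
    ultimately show ?case using step2 by (metis add_right_cancel)
  qed
  have key: "finprod (G Mod B) (\<lambda>i. \<pi> (v i) [^]\<^bsub>G Mod B\<^esub> k i) {..<n} = \<pi> (\<Sum>i<n. zmul (k i) (v i))"
    if v: "v ` {..<n} \<subseteq> Z" for v n and k :: "nat \<Rightarrow> int"
    using v
  proof (induction n)
    case 0
    then show ?case using \<pi>_one[of 0] add_subgroup_0[OF Z] add_subgroup_0[OF B(1)] by simp
  next
    case (Suc n)
    have vn: "v n \<in> Z" "\<And>i. i < n \<Longrightarrow> v i \<in> Z" using Suc.prems by auto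
    have s: "(\<Sum>i<n. zmul (k i) (v i)) \<in> Z" by (intro add_subgroup_sum add_subgroup_zmul Z vn) auto
    have "finprod (G Mod B) (\<lambda>i. \<pi> (v i) [^]\<^bsub>G Mod B\<^esub> k i) {..<Suc n}
       = \<pi> (v n) [^]\<^bsub>G Mod B\<^esub> k n \<otimes>\<^bsub>G Mod B\<^esub> \<pi> (\<Sum>i<n. zmul (k i) (v i))"
      using Suc vn by (simp add: lessThan_Suc image_subset_iff)
    also have "\<dots> = \<pi> (zmul (k n) (v n)) \<otimes>\<^bsub>G Mod B\<^esub> \<pi> (\<Sum>i<n. zmul (k i) (v i))"
      using vn pow \<pi>.hom_int_pow[of "v n" "k n"] by simp
    also have "\<dots> = \<pi> (zmul (k n) (v n) + (\<Sum>i<n. zmul (k i) (v i)))"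
      using \<pi>.hom_mult[of "zmul (k n) (v n)"] s vn add_subgroup_zmul[OF Z] by simp
    finally show ?case by (simp add: add.commute)
  qed
  have sumZ: "(\<Sum>i<n. zmul (k i) (v i)) \<in> Z" if v: "v ` {..<n} \<subseteq> Z" for v n and k :: "nat \<Rightarrow> int"
    using v by (intro add_subgroup_sum add_subgroup_zmul Z) auto
  have "enat n \<le> ab_rank (G Mod B) \<longleftrightarrow> enat n \<le> quotient_rank Z B" for n
    unfolding enat_le_ab_rank_iff[OF Q.comm_group_axioms] enat_le_quotient_rank_iff
  proof
    assume "\<exists>D. Z_independent (G Mod B) D \<and> card D = n"
    then obtain D where D: "Z_independent (G Mod B) D" "card D = n" by blast
    then obtain h where h: "bij_betw h {..<n} D"
      by (metis Z_independent_def atLeast0LessThan ex_bij_betw_nat_finite)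
    have "\<exists>x\<in>Z. h i = \<pi> x" if "i < n" for i
    proof -
      have "h i \<in> carrier (G Mod B)" using D h that by (auto simp: Z_independent_def bij_betw_def)
      then show ?thesis by (auto simp: FactGroup_def RCOSETS_def \<pi>_def)
    qed
    then obtain v where v: "\<And>i. i < n \<Longrightarrow> v i \<in> Z \<and> h i = \<pi> (v i)" by metis
    then have vZ: "v ` {..<n} \<subseteq> Z" by auto
    have "indep_mod B n v"
      unfolding indep_mod_def
    proof (intro allI impI)
      fix k i assume k: "(\<Sum>i<n. zmul (k i) (v i)) \<in> B" and i: "i < n"
      let ?k = "\<lambda>x. k (inv_into {..<n} h x)"
      have inv: "inv_into {..<n} h (h i) = i" if "i < n" for i
        using h that by (simp add: bij_betw_inv_into_left)
      have "finprod (G Mod B) (\<lambda>x. x [^]\<^bsub>G Mod B\<^esub> ?k x) D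
          = finprod (G Mod B) (\<lambda>x. x [^]\<^bsub>G Mod B\<^esub> ?k x) (h ` {..<n})"
        using h by (simp add: bij_betw_def)
      also have "\<dots> = finprod (G Mod B) (\<lambda>i. h i [^]\<^bsub>G Mod B\<^esub> ?k (h i)) {..<n}"
        using h v by (intro Q.finprod_reindex) (auto simp: bij_betw_def)
      also have "\<dots> = finprod (G Mod B) (\<lambda>i. \<pi> (v i) [^]\<^bsub>G Mod B\<^esub> k i) {..<n}"
      proof (rule Q.finprod_cong')
        show "(\<lambda>i. \<pi> (v i) [^]\<^bsub>G Mod B\<^esub> k i) \<in> {..<n} \<rightarrow> carrier (G Mod B)"
          using v by (auto intro!: Q.int_pow_closed \<pi>.hom_closed)
        show "h j [^]\<^bsub>G Mod B\<^esub> ?k (h j) = \<pi> (v j) [^]\<^bsub>G Mod B\<^esub> k j" if "j \<in> {..<n}" for j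
          using that v[of j] inv[of j] by simp
      qed simp
      also have "\<dots> = \<pi> (\<Sum>i<n. zmul (k i) (v i))" by (rule key[OF vZ])
      also have "\<dots> = \<one>\<^bsub>G Mod B\<^esub>" using k \<pi>_one[OF sumZ[OF vZ]] by blast
      finally have "\<forall>x\<in>D. ?k x = 0"
        by (rule mp[OF spec[OF D(1)[unfolded Z_independent_def, THEN conjunct2, THEN conjunct2], of ?k]])
      moreover have "h i \<in> D" using h i by (auto simp: bij_betw_def)
      ultimately show "k i = 0" using inv[OF i] by metis
    qed
    then show "\<exists>v. v ` {..<n} \<subseteq> Z \<and> indep_mod B n v" using vZ by blast
  next
    assume "\<exists>v. v ` {..<n} \<subseteq> Z \<and> indep_mod B n v"
    then obtain v where v: "v ` {..<n} \<subseteq> Z" "indep_mod B n v" by blast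
    have ind: "\<forall>i<n. k i = 0" if "finprod (G Mod B) (\<lambda>i. \<pi> (v i) [^]\<^bsub>G Mod B\<^esub> k i) {..<n} = \<one>\<^bsub>G Mod B\<^esub>"
      for k :: "nat \<Rightarrow> int"
    proof -
      have "\<pi> (\<Sum>i<n. zmul (k i) (v i)) = \<one>\<^bsub>G Mod B\<^esub>" by (rule trans[OF key[OF v(1), symmetric] that])
      then have "(\<Sum>i<n. zmul (k i) (v i)) \<in> B" using \<pi>_one[OF sumZ[OF v(1)]] by blast
      then show ?thesis by (rule mp[OF spec[OF v(2)[unfolded indep_mod_def], of k]])
    qed
    have inj: "inj_on (\<lambda>i. \<pi> (v i)) {..<n}"
    proof (rule inj_onI, rule ccontr)
      fix i j assume ij: "i \<in> {..<n}" "j \<in> {..<n}" "\<pi> (v i) = \<pi> (v j)" "i \<noteq> j"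
      \<comment> \<open>A repeated coset would give the relation with coefficients 1 and -1, so an
        independent family has distinct cosets and its image has \<open>n\<close> elements.\<close>
      let ?k = "\<lambda>l. if l = i then 1 else if l = j then - 1 else (0::int)"
      have "(\<Sum>l<n. zmul (?k l) (v l)) = (\<Sum>l\<in>{i,j}. zmul (?k l) (v l))"
        using ij by (intro sum.mono_neutral_right) auto
      also have "\<dots> = v i - v j" using ij by (simp add: zmul_minus_left)
      finally have s: "(\<Sum>l<n. zmul (?k l) (v l)) = v i - v j" .
      have vZ: "v i \<in> Z" "v j \<in> Z" using v(1) ij by auto
      then have "\<pi> (v i - v j) \<otimes>\<^bsub>G Mod B\<^esub> \<pi> (v j) = \<pi> (v i)"
        using \<pi>.hom_mult[of "v i - v j" "v j"] add_subgroup_diff[OF Z] by simp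
      then have "\<pi> (v i - v j) \<otimes>\<^bsub>G Mod B\<^esub> \<pi> (v j) = \<pi> (v j)" using ij(3) by (rule trans)
      moreover have "\<pi> (v i - v j) \<in> carrier (G Mod B)" "\<pi> (v j) \<in> carrier (G Mod B)"
        using vZ add_subgroup_diff[OF Z] by (simp_all add: \<pi>.hom_closed)
      ultimately have "\<pi> (v i - v j) = \<one>\<^bsub>G Mod B\<^esub>"
        using Q.r_cancel_one by metis
      then have "v i - v j \<in> B" using vZ \<pi>_one add_subgroup_diff[OF Z] by blast
      then have "(\<Sum>l<n. zmul (?k l) (v l)) \<in> B" unfolding s .
      then have "\<forall>l<n. ?k l = 0" by (rule mp[OF spec[OF v(2)[unfolded indep_mod_def], of ?k]])
      then have "?k i = 0" using ij(1) by blast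
      then show False by simp
    qed
    have "Z_independent (G Mod B) ((\<lambda>i. \<pi> (v i)) ` {..<n})"
      unfolding Z_independent_def
    proof (intro conjI allI impI)
      show \<pi>_closed: "(\<lambda>i. \<pi> (v i)) ` {..<n} \<subseteq> carrier (G Mod B)"
        using v(1) \<pi>.hom_closed by (metis (no_types, lifting) G(1) image_subset_iff)
      fix k :: "_ \<Rightarrow> int"
      assume k: "finprod (G Mod B) (\<lambda>x. x [^]\<^bsub>G Mod B\<^esub> k x) ((\<lambda>i. \<pi> (v i)) ` {..<n}) = \<one>\<^bsub>G Mod B\<^esub>"
      have cl: "(\<lambda>x. x [^]\<^bsub>G Mod B\<^esub> k x) \<in> (\<lambda>i. \<pi> (v i)) ` {..<n} \<rightarrow> carrier (G Mod B)"
        by (rule funcsetI, rule Q.int_pow_closed, rule subsetD[OF \<pi>_closed])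
      have "finprod (G Mod B) (\<lambda>i. \<pi> (v i) [^]\<^bsub>G Mod B\<^esub> k (\<pi> (v i))) {..<n} = \<one>\<^bsub>G Mod B\<^esub>"
        by (rule trans[OF Q.finprod_reindex[OF cl inj, symmetric] k])
      then have "\<forall>i<n. k (\<pi> (v i)) = 0" by (rule ind)
      then show "\<forall>x\<in>(\<lambda>i. \<pi> (v i)) ` {..<n}. k x = 0" by blast
    next
      show "finite ((\<lambda>i. \<pi> (v i)) ` {..<n})" by blast
    qed
    then show "\<exists>D. Z_independent (G Mod B) D \<and> card D = n"
      using card_image[OF inj] by (metis card_lessThan)
  qed
  then show ?thesis unfolding G_def by (meson antisym enat_le_via_nat)
qed

section \<open>Chains with coefficients\<close>

text \<open>The elementary tensor of \<open>z\<close> and \<open>g\<close>, where the tensor product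
  of the free abelian group on the generators with the coefficient group is identified with finitely
  supported coefficient functions.\<close>

definition chain_tensor :: "('s \<Rightarrow>\<^sub>0 int) \<Rightarrow> 'g::ab_group_add \<Rightarrow> ('s \<Rightarrow>\<^sub>0 'g)" where
  "chain_tensor z g = (\<Sum>s\<in>Poly_Mapping.keys z. Poly_Mapping.single s (zmul (Poly_Mapping.lookup z s) g))"

lemma lookup_chain_tensor: "Poly_Mapping.lookup (chain_tensor z g) s = zmul (Poly_Mapping.lookup z s) g"
proof -
  have "Poly_Mapping.lookup (chain_tensor z g) s
      = (\<Sum>s'\<in>Poly_Mapping.keys z. if s' = s then zmul (Poly_Mapping.lookup z s') g else 0)"
    by (simp add: chain_tensor_def lookup_sum lookup_single when_def)
  also have "\<dots> = zmul (Poly_Mapping.lookup z s) g"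
    by (auto simp: sum.delta in_keys_iff)
  finally show ?thesis .
qed

lemma keys_chain_tensor: "Poly_Mapping.keys (chain_tensor z g) \<subseteq> Poly_Mapping.keys z"
  by (auto simp: in_keys_iff lookup_chain_tensor)

lemma chain_tensor_0 [simp]: "chain_tensor 0 g = 0" "chain_tensor z 0 = 0"
  by (auto intro!: poly_mapping_eqI simp: lookup_chain_tensor)

lemma chain_tensor_of [simp]: "chain_tensor (frag_of s) g = Poly_Mapping.single s g"
  by (rule poly_mapping_eqI) (auto simp: lookup_chain_tensor lookup_single when_def)

lemma chain_tensor_add: "chain_tensor (y + z) g = chain_tensor y g + chain_tensor z g"
  by (rule poly_mapping_eqI) (simp add: lookup_chain_tensor lookup_add zmul_add_left)

lemma chain_tensor_minus: "chain_tensor (- z) g = - chain_tensor z g"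
  by (rule poly_mapping_eqI) (simp add: lookup_chain_tensor zmul_minus_left)

lemma chain_tensor_diff: "chain_tensor (y - z) g = chain_tensor y g - chain_tensor z g"
  using chain_tensor_add[of y "- z" g] by (simp add: chain_tensor_minus)

lemma chain_tensor_sum: "chain_tensor (sum f I) g = (\<Sum>i\<in>I. chain_tensor (f i) g)"
  by (induction I rule: infinite_finite_induct) (auto simp: chain_tensor_add)

lemma chain_tensor_add_right: "chain_tensor z (g + h) = chain_tensor z g + chain_tensor z h"
  by (rule poly_mapping_eqI) (simp add: lookup_chain_tensor lookup_add zmul_add_right)

lemma chain_tensor_cmul: "chain_tensor (frag_cmul k z) g = chain_tensor z (zmul k g)"
  by (rule poly_mapping_eqI) (simp add: lookup_chain_tensor zmul_zmul mult.commute)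

text \<open>\<open>chain_lift F\<close> is the homomorphism \<open>\<int>[S] \<otimes> G \<rightarrow> \<int>[T] \<otimes> G\<close> induced by the homomorphism
  \<open>\<int>[S] \<rightarrow> \<int>[T]\<close> that sends the generator \<open>s\<close> to \<open>F s\<close>; it transports identities between
  operators on integral chains to chains with coefficients.\<close>

definition chain_lift :: "('s \<Rightarrow> ('t \<Rightarrow>\<^sub>0 int)) \<Rightarrow> ('s \<Rightarrow>\<^sub>0 'g::ab_group_add) \<Rightarrow> ('t \<Rightarrow>\<^sub>0 'g)" where
  "chain_lift F c = (\<Sum>s\<in>Poly_Mapping.keys c. chain_tensor (F s) (Poly_Mapping.lookup c s))"

lemma chain_lift_superset:
  assumes "finite S" "Poly_Mapping.keys c \<subseteq> S"
  shows "chain_lift F c = (\<Sum>s\<in>S. chain_tensor (F s) (Poly_Mapping.lookup c s))"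
  unfolding chain_lift_def using assms
  by (intro sum.mono_neutral_left) (auto simp: in_keys_iff)

lemma chain_lift_0 [simp]: "chain_lift F 0 = 0"
  by (simp add: chain_lift_def)

lemma chain_lift_add: "chain_lift F (c + d) = chain_lift F c + chain_lift F d"
proof -
  let ?S = "Poly_Mapping.keys c \<union> Poly_Mapping.keys d"
  have "chain_lift F (c + d) = (\<Sum>s\<in>?S. chain_tensor (F s) (Poly_Mapping.lookup (c + d) s))"
    by (rule chain_lift_superset) (auto simp: keys_add)
  also have "\<dots> = (\<Sum>s\<in>?S. chain_tensor (F s) (Poly_Mapping.lookup c s)) + (\<Sum>s\<in>?S. chain_tensor (F s) (Poly_Mapping.lookup d s))"
    by (simp add: lookup_add chain_tensor_add_right sum.distrib)
  also have "\<dots> = chain_lift F c + chain_lift F d"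
    by (simp add: chain_lift_superset[of ?S])
  finally show ?thesis .
qed

lemma chain_lift_minus: "chain_lift F (- c) = - chain_lift F c"
  using chain_lift_add[of F "-c" c] by (simp add: eq_neg_iff_add_eq_0)

lemma chain_lift_diff: "chain_lift F (c - d) = chain_lift F c - chain_lift F d"
  using chain_lift_add[of F c "- d"] by (simp add: chain_lift_minus)

lemma chain_lift_sum: "chain_lift F (sum f I) = (\<Sum>i\<in>I. chain_lift F (f i))"
  by (induction I rule: infinite_finite_induct) (auto simp: chain_lift_add)

lemma chain_lift_single [simp]: "chain_lift F (Poly_Mapping.single s g) = chain_tensor (F s) g"
  by (simp add: chain_lift_superset[of "{s}"])

lemma chain_lift_cong:
  "(\<And>s. s \<in> Poly_Mapping.keys c \<Longrightarrow> F s = F' s) \<Longrightarrow> chain_lift F c = chain_lift F' c"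
  by (simp add: chain_lift_def)

lemma chain_lift_fun_diff: "chain_lift (\<lambda>s. F s - F' s) c = chain_lift F c - chain_lift F' c"
  by (simp add: chain_lift_def chain_tensor_diff sum_subtractf)

lemma chain_lift_fun_0 [simp]: "chain_lift (\<lambda>s. 0) c = 0"
  by (simp add: chain_lift_def)

lemma chain_lift_frag_of [simp]: "chain_lift frag_of c = c"
proof (rule poly_mapping_eqI)
  fix s
  have "Poly_Mapping.lookup (chain_lift frag_of c) s
      = (\<Sum>s'\<in>Poly_Mapping.keys c. if s' = s then Poly_Mapping.lookup c s' else 0)"
    by (simp add: chain_lift_def lookup_sum lookup_single when_def)
  then show "Poly_Mapping.lookup (chain_lift frag_of c) s = Poly_Mapping.lookup c s"
    by (auto simp: sum.delta in_keys_iff)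
qed

lemma chain_lift_tensor: "chain_lift F (chain_tensor z g) = chain_tensor (frag_extend F z) g"
  using subset_UNIV
  by (induction z rule: frag_induction)
    (auto simp: chain_tensor_diff chain_lift_diff frag_extend_diff)

lemma chain_lift_comp: "chain_lift F (chain_lift F' c) = chain_lift (\<lambda>s. frag_extend F (F' s)) c"
  unfolding chain_lift_def[of F' c] chain_lift_sum chain_lift_tensor
  by (simp add: chain_lift_def)

lemma keys_chain_lift:
  "Poly_Mapping.keys (chain_lift F c) \<subseteq> (\<Union>s\<in>Poly_Mapping.keys c. Poly_Mapping.keys (F s))"
  unfolding chain_lift_def using keys_sum keys_chain_tensor by fastforce

lemma coeff_chain_lift:
  assumes "\<And>f. f \<in> Poly_Mapping.keys c \<Longrightarrow> singular_chain q X (F f)"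
  shows "coeff_chain q X (chain_lift F c)"
  using keys_chain_lift[of F c] assms unfolding coeff_chain_def singular_chain_def by blast

text \<open>The sign on each coefficient moves to the integral boundary of a single simplex.
  Identities such as the vanishing of the double boundary are then inherited simplex by simplex from
  integral chains.\<close>

lemma coeff_boundary_eq_lift: "coeff_boundary p = chain_lift (\<lambda>f. chain_boundary p (frag_of f))"
proof
  fix c :: "('a, 'g::ab_group_add) gchain"
  have "chain_tensor (chain_boundary p (frag_of f)) g
      = (\<Sum>k\<le>p. Poly_Mapping.single (singular_face p k f) (if even k then g else - g))"
    if "p \<noteq> 0" for f :: "(nat \<Rightarrow> real) \<Rightarrow> 'a" and g :: 'g
    using that by (simp add: chain_boundary_of chain_tensor_sum chain_tensor_cmul zmul_minus_left
        minus_one_power_iff if_distrib[of "\<lambda>k. zmul k g"] cong: if_cong)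
  then show "coeff_boundary p c = chain_lift (\<lambda>f. chain_boundary p (frag_of f)) c"
    by (cases "p = 0") (simp_all add: coeff_boundary_def chain_lift_def chain_boundary_def)
qed

lemma frag_extend_chain_boundary: "frag_extend (\<lambda>f. chain_boundary p (frag_of f)) z = chain_boundary p z"
  using subset_UNIV
  by (induction z rule: frag_induction) (auto simp: frag_extend_diff chain_boundary_diff)

lemma coeff_boundary_0 [simp]: "coeff_boundary 0 c = 0"
  by (simp add: coeff_boundary_def)

lemma coeff_boundary_diff: "coeff_boundary p (c - d) = coeff_boundary p c - coeff_boundary p d"
  and coeff_boundary_add: "coeff_boundary p (c + d) = coeff_boundary p c + coeff_boundary p d"
  and coeff_boundary_zero [simp]: "coeff_boundary p 0 = 0"
  by (simp_all add: coeff_boundary_eq_lift chain_lift_diff chain_lift_add)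

lemma coeff_boundary_lift:
  "coeff_boundary p (chain_lift F c) = chain_lift (\<lambda>s. chain_boundary p (F s)) c"
  by (simp add: coeff_boundary_eq_lift chain_lift_comp frag_extend_chain_boundary)

lemma coeff_boundary_boundary:
  assumes "coeff_chain (Suc p) X c"
  shows "coeff_boundary p (coeff_boundary (Suc p) c) = 0"
proof -
  have "coeff_boundary p (coeff_boundary (Suc p) c)
      = chain_lift (\<lambda>f. chain_boundary p (chain_boundary (Suc p) (frag_of f))) c"
    unfolding coeff_boundary_eq_lift[of "Suc p"] by (rule coeff_boundary_lift)
  also have "\<dots> = chain_lift (\<lambda>f. 0) c"
    using assms by (intro chain_lift_cong chain_boundary_boundary_alt[where X=X])
      (auto simp: coeff_chain_def singular_chain_of)
  finally show ?thesis by simp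
qed

lemma coeff_chain_boundary:
  assumes "coeff_chain p X c"
  shows "coeff_chain (p - 1) X (coeff_boundary p c)"
  unfolding coeff_boundary_eq_lift
proof (rule coeff_chain_lift)
  fix f assume "f \<in> Poly_Mapping.keys c"
  then have "singular_chain p X (frag_of f)"
    using assms by (auto simp: coeff_chain_def singular_chain_of)
  then show "singular_chain (p - 1) X (chain_boundary p (frag_of f))"
    using singular_chain_boundary by fastforce
qed

section \<open>Relative cycles and boundaries of pairs of subsets\<close>

lemma add_subgroup_coeff_chain: "add_subgroup (Collect (coeff_chain p X))"
  unfolding add_subgroup_def coeff_chain_def using keys_diff by fastforce

abbreviation coeff_chains :: "nat \<Rightarrow> 'a::topological_space set \<Rightarrow> ('a, 'g::ab_group_add) gchain set" where
  "coeff_chains p A \<equiv> Collect (coeff_chain p (top_of_set A))"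

lemma coeff_chains_mono: "A \<subseteq> B \<Longrightarrow> coeff_chains p A \<subseteq> coeff_chains p B"
  unfolding coeff_chain_def using singular_simplex_mono[of p euclidean A _ B] by blast

lemma coeff_chain_0 [simp]: "coeff_chain p X 0"
  by (simp add: coeff_chain_def)

text \<open>Chains of all subsets share one ambient type, so maps induced by inclusions are the
  identity on chains. For \<open>q = 0\<close> the truncated \<open>q - 1\<close> is harmless
  because the boundary is then 0.\<close>

definition rel_cycles :: "nat \<Rightarrow> 'a::topological_space set \<Rightarrow> 'a set \<Rightarrow> ('a, 'g::ab_group_add) gchain set" where
  "rel_cycles q P Q = {c \<in> coeff_chains q P. coeff_boundary q c \<in> coeff_chains (q - 1) Q}"

definition rel_boundaries :: "nat \<Rightarrow> 'a::topological_space set \<Rightarrow> 'a set \<Rightarrow> ('a, 'g::ab_group_add) gchain set" where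
  "rel_boundaries q P Q = {c. \<exists>d\<in>coeff_chains (Suc q) P. coeff_boundary (Suc q) d - c \<in> coeff_chains q Q}"

lemma rel_boundariesI:
  "\<lbrakk>d \<in> coeff_chains (Suc q) P; coeff_boundary (Suc q) d - c \<in> coeff_chains q Q\<rbrakk>
    \<Longrightarrow> c \<in> rel_boundaries q P Q"
  unfolding rel_boundaries_def by blast

lemma add_subgroup_rel_cycles: "add_subgroup (rel_cycles q P Q)"
  unfolding add_subgroup_def rel_cycles_def
  by (auto simp: coeff_boundary_diff add_subgroup_diff[OF add_subgroup_coeff_chain, simplified])

lemma add_subgroup_rel_boundaries: "add_subgroup (rel_boundaries q P Q)"
  unfolding add_subgroup_def
proof (intro conjI ballI)
  show "0 \<in> rel_boundaries q P Q" by (auto simp: rel_boundaries_def intro!: exI[of _ 0])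
  fix x y :: "('a, 'g::ab_group_add) gchain" assume "x \<in> rel_boundaries q P Q" "y \<in> rel_boundaries q P Q"
  then obtain d e where de: "d \<in> coeff_chains (Suc q) P" "coeff_boundary (Suc q) d - x \<in> coeff_chains q Q"
    "e \<in> coeff_chains (Suc q) P" "coeff_boundary (Suc q) e - y \<in> coeff_chains q Q"
    by (auto simp: rel_boundaries_def)
  then have "d - e \<in> coeff_chains (Suc q) P"
    using add_subgroup_diff[OF add_subgroup_coeff_chain] by blast
  moreover have "coeff_boundary (Suc q) (d - e) - (x - y)
      = (coeff_boundary (Suc q) d - x) - (coeff_boundary (Suc q) e - y)"
    by (simp add: coeff_boundary_diff)
  moreover have "(coeff_boundary (Suc q) d - x) - (coeff_boundary (Suc q) e - y) \<in> coeff_chains q Q"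
    by (rule add_subgroup_diff[OF add_subgroup_coeff_chain de(2,4)])
  ultimately show "x - y \<in> rel_boundaries q P Q"
    by (intro rel_boundariesI[of "d - e"]) (simp_all only: coeff_chain_0 mem_Collect_eq)
qed

lemma rel_boundaries_subset_cycles:
  assumes "Q \<subseteq> P"
  shows "rel_boundaries q P Q \<subseteq> rel_cycles q P Q"
proof
  fix c :: "('a, 'g::ab_group_add) gchain" assume "c \<in> rel_boundaries q P Q"
  then obtain d where d: "d \<in> coeff_chains (Suc q) P" "coeff_boundary (Suc q) d - c \<in> coeff_chains q Q"
    by (auto simp: rel_boundaries_def)
  let ?e = "coeff_boundary (Suc q) d - c"
  have 1: "coeff_boundary (Suc q) d \<in> coeff_chains q P" using d coeff_chain_boundary[of "Suc q"] by force
  have "?e \<in> coeff_chains q P" using d coeff_chains_mono[OF assms] by blast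
  then have "coeff_boundary (Suc q) d - ?e \<in> coeff_chains q P"
    using 1 add_subgroup_diff[OF add_subgroup_coeff_chain] by blast
  then have cP: "c \<in> coeff_chains q P" by simp
  have "coeff_boundary q ?e = - coeff_boundary q c"
    unfolding coeff_boundary_diff using coeff_boundary_boundary d by auto
  then have "coeff_boundary q c = - coeff_boundary q ?e" by simp
  moreover have "coeff_boundary q ?e \<in> coeff_chains (q - 1) Q" using d coeff_chain_boundary by blast
  ultimately have "coeff_boundary q c \<in> coeff_chains (q - 1) Q"
    using add_subgroup_uminus[OF add_subgroup_coeff_chain] by metis
  with cP show "c \<in> rel_cycles q P Q" by (simp add: rel_cycles_def)
qed

lemma ab_rank_coeff_relhomology:
  assumes "Q \<subseteq> P"
  shows "ab_rank (coeff_relhomology q (top_of_set P) Q :: ('a::topological_space, 'g::ab_group_add) gchain set monoid)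
    = quotient_rank (rel_cycles q P Q :: ('a, 'g) gchain set) (rel_boundaries q P Q)"
proof -
  have s: "subtopology (top_of_set P) Q = top_of_set Q"
    using assms by (simp add: subtopology_subtopology inf.absorb2)
  have 1: "Collect (coeff_relcycle q (top_of_set P) Q) = (rel_cycles q P Q :: ('a, 'g) gchain set)"
    by (auto simp: coeff_relcycle_def rel_cycles_def s)
  have 2: "Collect (coeff_relboundary q (top_of_set P) Q) = (rel_boundaries q P Q :: ('a, 'g) gchain set)"
    by (auto simp: coeff_relboundary_def rel_boundaries_def s)
  show ?thesis
    unfolding coeff_relhomology_def coeff_relcycle_group_def 1 2
    by (intro ab_rank_quotient add_subgroup_rel_cycles add_subgroup_rel_boundaries
        rel_boundaries_subset_cycles assms)
qed

text \<open>This is the rank count in the long exact sequence of the triple: \<open>D q\<close> is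
  the rank of the connecting homomorphism from H_q(P,Q) to H_{q-1}(Q,R). Each homology group is
  split at the image or kernel of a map of the sequence, without subtraction, so infinite ranks are
  allowed.\<close>

lemma quotient_rank_triple:
  fixes P Q R :: "'a::topological_space set"
  assumes "R \<subseteq> Q" "Q \<subseteq> P"
  obtains D where "D 0 = 0" and
    "\<And>q. quotient_rank (rel_cycles q P Q :: ('a, 'g::ab_group_add) gchain set) (rel_boundaries q P Q)
        + quotient_rank (rel_cycles q Q R :: ('a, 'g) gchain set) (rel_boundaries q Q R)
        = quotient_rank (rel_cycles q P R :: ('a, 'g) gchain set) (rel_boundaries q P R) + D q + D (Suc q)"
proof -
  let ?Z = "rel_cycles :: nat \<Rightarrow> _ \<Rightarrow> _ \<Rightarrow> ('a, 'g) gchain set"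
  let ?B = "rel_boundaries :: nat \<Rightarrow> _ \<Rightarrow> _ \<Rightarrow> ('a, 'g) gchain set"
  let ?bd = "\<lambda>q. coeff_boundary q :: ('a, 'g) gchain \<Rightarrow> ('a, 'g) gchain"
  have RP: "R \<subseteq> P" using assms by blast
  note sg = add_subgroup_rel_cycles add_subgroup_rel_boundaries
  have CRQ: "c \<in> coeff_chains q Q" if "c \<in> coeff_chains q R" for q and c :: "('a, 'g) gchain"
    using that coeff_chains_mono[OF assms(1)] by blast
  have CQP: "c \<in> coeff_chains q P" if "c \<in> coeff_chains q Q" for q and c :: "('a, 'g) gchain"
    using that coeff_chains_mono[OF assms(2)] by blast
  note Cdiff = add_subgroup_diff[OF add_subgroup_coeff_chain]
  have ZPRQ: "?Z q P R \<subseteq> ?Z q P Q" for q unfolding rel_cycles_def using CRQ by blast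
  have ZQP: "?Z q Q R \<subseteq> ?Z q P R" for q unfolding rel_cycles_def using CQP by blast
  have BPRQ: "?B q P R \<subseteq> ?B q P Q" for q unfolding rel_boundaries_def using CRQ by blast
  have BQP: "?B q Q R \<subseteq> ?B q P R" for q unfolding rel_boundaries_def using CQP by blast
  have BQ: "c \<in> ?B q P Q" if "c \<in> coeff_chains q Q" for q c
    using that add_subgroup_uminus[OF add_subgroup_coeff_chain, of c q "top_of_set Q"]
    by (auto simp: rel_boundaries_def intro!: exI[of _ 0])
  \<comment> \<open>\<open>I q\<close> consists of the cycles whose class comes from H_q(P,R); the
    quotient by it is the cokernel of H_q(P,R) \<rightarrow> H_q(P,Q).\<close>
  define I where "I q = {c \<in> ?Z q P Q. \<exists>x\<in>?Z q P R. c - x \<in> ?B q P Q}" for q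
  have sgI: "add_subgroup (I q)" for q
    unfolding add_subgroup_def
  proof (intro conjI ballI)
    show "0 \<in> I q" using add_subgroup_0[OF sg(1)] add_subgroup_0[OF sg(2)] by (force simp: I_def)
    fix c d assume "c \<in> I q" "d \<in> I q"
    then obtain x y where "c \<in> ?Z q P Q" "d \<in> ?Z q P Q" "x \<in> ?Z q P R" "y \<in> ?Z q P R" "c - x \<in> ?B q P Q" "d - y \<in> ?B q P Q"
      by (auto simp: I_def)
    then have "c - d \<in> ?Z q P Q" "x - y \<in> ?Z q P R" "(c - x) - (d - y) \<in> ?B q P Q"
      using add_subgroup_diff[OF sg(1)] add_subgroup_diff[OF sg(2)] by blast+
    moreover have "(c - d) - (x - y) = (c - x) - (d - y)" by simp
    ultimately show "c - d \<in> I q"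
      unfolding I_def by (intro CollectI conjI bexI[of _ "x - y"]) (simp_all only:)
  qed
  have BI: "?B q P Q \<subseteq> I q" for q
    using rel_boundaries_subset_cycles[OF assms(2)] add_subgroup_0[OF sg(1)]
    unfolding I_def by force
  have sgInt: "add_subgroup (X \<inter> Y)" if "add_subgroup X" "add_subgroup Y" for X Y :: "('a, 'g) gchain set"
    using that by (auto simp: add_subgroup_def)
  define D where "D q = quotient_rank (?Z q P Q) (I q)" for q
  show thesis
  proof
    \<comment> \<open>In degree 0 every chain of \<open>P\<close> is a cycle for both pairs, so
      every class comes from H_0(P,R).\<close>
    have "?Z 0 P Q = ?Z 0 P R" by (simp add: rel_cycles_def)
    then have "I 0 = ?Z 0 P Q" unfolding I_def using add_subgroup_0[OF sg(2)] by force
    then show "D 0 = 0" by (simp add: D_def quotient_rank_self[OF sg(1)])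
  next
    fix q
    have 1: "quotient_rank (?Z q P Q) (?B q P Q) = D q + quotient_rank (I q) (?B q P Q)"
      unfolding D_def by (rule quotient_rank_additive) (use BI sg sgI in \<open>auto simp: I_def\<close>)
    have 2: "quotient_rank (I q) (?B q P Q) = quotient_rank (?Z q P R) (?Z q P R \<inter> ?B q P Q)"
    proof (rule quotient_rank_eq_of_map[of "\<lambda>x. x", symmetric])
      show "\<exists>z\<in>?Z q P R. z - c \<in> ?B q P Q" if "c \<in> I q" for c
        using that add_subgroup_uminus[OF sg(2), of "c - x" for x] unfolding I_def by force
      show "z \<in> I q" if "z \<in> ?Z q P R" for z
        using that ZPRQ add_subgroup_0[OF sg(2)] by (force simp: I_def)
    qed (use sg in auto)
    have 3: "quotient_rank (?Z q P R) (?B q P R)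
      = quotient_rank (?Z q P R) (?Z q P R \<inter> ?B q P Q) + quotient_rank (?Z q P R \<inter> ?B q P Q) (?B q P R)"
      by (rule quotient_rank_additive)
        (use rel_boundaries_subset_cycles[OF RP] BPRQ sg in \<open>auto intro!: sgInt\<close>)
    have 4: "quotient_rank (?Z q Q R) (?B q Q R)
      = quotient_rank (?Z q Q R) (?Z q Q R \<inter> ?B q P R) + quotient_rank (?Z q Q R \<inter> ?B q P R) (?B q Q R)"
      by (rule quotient_rank_additive)
        (use rel_boundaries_subset_cycles[OF assms(1)] BQP sg in \<open>auto intro!: sgInt\<close>)
    \<comment> \<open>Exactness at H_q(P,R): a cycle that bounds modulo \<open>Q\<close> becomes a
      cycle of \<open>(Q, R)\<close> after the boundary of the bounding chain is subtracted.\<close>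
    have 5: "quotient_rank (?Z q Q R) (?Z q Q R \<inter> ?B q P R) = quotient_rank (?Z q P R \<inter> ?B q P Q) (?B q P R)"
    proof (rule quotient_rank_eq_of_map[of "\<lambda>x. x"])
      show "z \<in> ?Z q P R \<inter> ?B q P Q" if "z \<in> ?Z q Q R" for z
        using that ZQP BQ by (auto simp: rel_cycles_def)
      show "\<exists>z\<in>?Z q Q R. z - c \<in> ?B q P R" if c: "c \<in> ?Z q P R \<inter> ?B q P Q" for c
      proof -
        obtain d where d: "d \<in> coeff_chains (Suc q) P" "?bd (Suc q) d - c \<in> coeff_chains q Q"
          using c by (auto simp: rel_boundaries_def)
        let ?e = "c - ?bd (Suc q) d"
        have "?bd q ?e = ?bd q c"
          using coeff_boundary_boundary d by (auto simp: coeff_boundary_diff)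
        moreover have "?e \<in> coeff_chains q Q"
          using add_subgroup_uminus[OF add_subgroup_coeff_chain d(2)] by simp
        ultimately have "?e \<in> ?Z q Q R" using c by (simp add: rel_cycles_def)
        moreover have "?e - c \<in> ?B q P R"
        proof -
          have "- d \<in> coeff_chains (Suc q) P" using d(1) by (rule add_subgroup_uminus[OF add_subgroup_coeff_chain])
          moreover have "?bd (Suc q) (- d) - (?e - c) = 0"
            using coeff_boundary_diff[of "Suc q" 0 d] by simp
          ultimately show ?thesis by (intro rel_boundariesI[of "- d"]) (simp_all only: coeff_chain_0 mem_Collect_eq)
        qed
        ultimately show ?thesis by blast
      qed
    qed (use sg in auto)
    \<comment> \<open>Exactness at the connecting map, which on representatives is the boundary: it
      identifies the cokernel counted by \<open>D (Suc q)\<close> with the kernel of H_q(Q,R)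
      \<rightarrow> H_q(P,R).\<close>
    have 6: "D (Suc q) = quotient_rank (?Z q Q R \<inter> ?B q P R) (?B q Q R)"
      unfolding D_def
    proof (rule quotient_rank_eq_of_map[of "?bd (Suc q)"])
      show "I (Suc q) \<subseteq> ?Z (Suc q) P Q" by (auto simp: I_def)
      show "?bd (Suc q) z \<in> ?Z q Q R \<inter> ?B q P R" if z: "z \<in> ?Z (Suc q) P Q" for z
      proof -
        have "?bd q (?bd (Suc q) z) = 0" using z coeff_boundary_boundary by (auto simp: rel_cycles_def)
        then show ?thesis using z
          by (auto simp: rel_cycles_def rel_boundaries_def intro!: exI[of _ z])
      qed
      show "?bd (Suc q) z \<in> ?B q Q R \<longleftrightarrow> z \<in> I (Suc q)" if z: "z \<in> ?Z (Suc q) P Q" for z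
      proof
        assume "?bd (Suc q) z \<in> ?B q Q R"
        then obtain d where d: "d \<in> coeff_chains (Suc q) Q" "?bd (Suc q) d - ?bd (Suc q) z \<in> coeff_chains q R"
          by (auto simp: rel_boundaries_def)
        have "z - d \<in> coeff_chains (Suc q) P" using z CQP[OF d(1)] Cdiff by (auto simp: rel_cycles_def)
        moreover have "?bd (Suc q) (z - d) \<in> coeff_chains q R"
          using add_subgroup_uminus[OF add_subgroup_coeff_chain d(2)] by (simp add: coeff_boundary_diff)
        ultimately have "z - d \<in> ?Z (Suc q) P R" by (simp add: rel_cycles_def)
        moreover have "z - (z - d) \<in> ?B (Suc q) P Q" using BQ[OF d(1)] by simp
        ultimately show "z \<in> I (Suc q)" using z unfolding I_def by blast
      next
        assume "z \<in> I (Suc q)"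
        then obtain x where x: "x \<in> ?Z (Suc q) P R" "z - x \<in> ?B (Suc q) P Q" by (auto simp: I_def)
        then obtain d where d: "d \<in> coeff_chains (Suc (Suc q)) P" "?bd (Suc (Suc q)) d - (z - x) \<in> coeff_chains (Suc q) Q"
          by (auto simp: rel_boundaries_def)
        let ?e = "?bd (Suc (Suc q)) d - (z - x)"
        have "?bd (Suc q) ?e = ?bd (Suc q) x - ?bd (Suc q) z"
          using coeff_boundary_boundary d by (auto simp: coeff_boundary_diff)
        then have "?bd (Suc q) (- ?e) - ?bd (Suc q) z = - ?bd (Suc q) x"
          using coeff_boundary_diff[of "Suc q" 0 ?e] by simp
        moreover have "- ?bd (Suc q) x \<in> coeff_chains q R"
          using x add_subgroup_uminus[OF add_subgroup_coeff_chain] by (auto simp: rel_cycles_def)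
        moreover have "- ?e \<in> coeff_chains (Suc q) Q"
          using d(2) by (rule add_subgroup_uminus[OF add_subgroup_coeff_chain])
        ultimately show "?bd (Suc q) z \<in> ?B q Q R" by (intro rel_boundariesI[of "- ?e"]) (simp_all only: coeff_chain_0 mem_Collect_eq)
      qed
      show "\<exists>z\<in>?Z (Suc q) P Q. ?bd (Suc q) z - c \<in> ?B q Q R" if c: "c \<in> ?Z q Q R \<inter> ?B q P R" for c
      proof -
        obtain d where d: "d \<in> coeff_chains (Suc q) P" "?bd (Suc q) d - c \<in> coeff_chains q R"
          using c by (auto simp: rel_boundaries_def)
        have "c \<in> coeff_chains q Q" using c by (simp add: rel_cycles_def)
        then have "(?bd (Suc q) d - c) + c \<in> coeff_chains q Q"
          using CRQ[OF d(2)] by (rule add_subgroup_add[OF add_subgroup_coeff_chain, rotated])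
        then have "d \<in> ?Z (Suc q) P Q" using d(1) by (simp add: rel_cycles_def)
        moreover have "?bd (Suc q) d - c \<in> ?B q Q R"
        proof (rule rel_boundariesI[of 0])
          show "?bd (Suc q) 0 - (?bd (Suc q) d - c) \<in> coeff_chains q R"
            using add_subgroup_uminus[OF add_subgroup_coeff_chain d(2)] by simp
        qed simp
        ultimately show ?thesis by blast
      qed
    qed (use sg in \<open>auto simp: coeff_boundary_add\<close>)
    show "quotient_rank (?Z q P Q) (?B q P Q) + quotient_rank (?Z q Q R) (?B q Q R)
        = quotient_rank (?Z q P R) (?B q P R) + D q + D (Suc q)"
      unfolding 1 2 3 4 5 6 by (simp add: ac_simps)
  qed
qed

section \<open>Homotopy invariance with coefficients\<close>

abbreviation simplex_space :: "nat \<Rightarrow> (nat \<Rightarrow> real) topology" where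
  "simplex_space q \<equiv> subtopology (powertop_real UNIV) (standard_simplex q)"

abbreviation interval_space :: "real topology" where
  "interval_space \<equiv> top_of_set {0..1}"

definition prism_space :: "nat \<Rightarrow> (real \<times> (nat \<Rightarrow> real)) topology" where
  "prism_space q = prod_topology interval_space (simplex_space q)"

lemma topspace_prism_space [simp]: "topspace (prism_space q) = {0..1} \<times> standard_simplex q"
  by (simp add: prism_space_def)

text \<open>The restriction is there because singular simplices are required to be extensional on
  the standard simplex.\<close>

definition prism_end :: "nat \<Rightarrow> real \<Rightarrow> (nat \<Rightarrow> real) \<Rightarrow> real \<times> (nat \<Rightarrow> real)" where
  "prism_end q s = restrict (Pair s) (standard_simplex q)"

definition simplex_id :: "nat \<Rightarrow> (nat \<Rightarrow> real) \<Rightarrow> (nat \<Rightarrow> real)" where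
  "simplex_id q = restrict (\<lambda>x. x) (standard_simplex q)"

lemma singular_simplex_id: "singular_simplex q (simplex_space q) (simplex_id q)"
  unfolding singular_simplex_def simplex_id_def
  by (auto intro: continuous_map_eq[OF continuous_map_id])

text \<open>The chain \<open>p\<close> plays the role of a triangulation of the prism over the model
  simplex. Pushing one fixed model chain forward makes the construction natural in the simplex
  \<open>f\<close> and the homotopy \<Phi>.\<close>

definition sweep ::
    "nat \<Rightarrow> (real \<times> (nat \<Rightarrow> real)) chain \<Rightarrow> (real \<times> 'a \<Rightarrow> 'b) \<Rightarrow> ((nat \<Rightarrow> real) \<Rightarrow> 'a) \<Rightarrow> 'b chain" where
  "sweep q p \<Phi> f = chain_map (Suc q) (\<lambda>(s, x). \<Phi> (s, f x)) p"

lemma continuous_map_prism: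
  assumes "singular_simplex q X f"
  shows "continuous_map (prism_space q) (prod_topology interval_space X) (\<lambda>(s, x). (s, f x))"
proof -
  have "continuous_map (prism_space q) X (f \<circ> snd)"
    using assms unfolding prism_space_def singular_simplex_def
    by (intro continuous_map_compose[OF continuous_map_snd]) auto
  moreover have "continuous_map (prism_space q) interval_space fst"
    unfolding prism_space_def by (rule continuous_map_fst)
  ultimately show ?thesis
    by (simp add: continuous_map_pairwise o_def case_prod_unfold)
qed

lemma singular_chain_sweep:
  assumes "singular_chain (Suc q) (prism_space q) p" "singular_simplex q X f"
    and "continuous_map (prod_topology interval_space X) Y \<Phi>"
  shows "singular_chain (Suc q) Y (sweep q p \<Phi> f)"
  unfolding sweep_def
proof (rule singular_chain_chain_map[OF assms(1)])
  show "continuous_map (prism_space q) Y (\<lambda>(s, x). \<Phi> (s, f x))"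
    using continuous_map_compose[OF continuous_map_prism[OF assms(2)] assms(3)]
    by (simp add: o_def case_prod_unfold)
qed

lemma singular_simplex_prism_end:
  assumes "s \<in> {0..1}"
  shows "singular_simplex q (prism_space q) (prism_end q s)"
proof -
  have "continuous_map (simplex_space q) (prism_space q) (Pair s)"
    using assms unfolding prism_space_def
    by (auto simp: continuous_map_pairwise o_def)
  then show ?thesis
    unfolding singular_simplex_def prism_end_def by (auto intro: continuous_map_eq)
qed

text \<open>The prism is convex, so it shrinks linearly to the vertex \<open>(0, v)\<close>. The
  predicate on maps is trivially true; it is the form for pairs with empty subspace.\<close>

lemma contract_prism_space:
  obtains a where "a \<in> topspace (prism_space q)"
    "homotopic_with (\<lambda>h. h \<in> {} \<rightarrow> {}) (prism_space q) (prism_space q) id (\<lambda>_. a)"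
proof
  define v :: "nat \<Rightarrow> real" where "v = (\<lambda>j. if j = 0 then 1 else 0)"
  define h where "h = (\<lambda>(u, s, x). ((1 - u) * s, \<lambda>i. (1 - u) * x i + u * v i :: real) :: real \<times> (nat \<Rightarrow> real))"
  have v: "v \<in> standard_simplex q" by (simp add: v_def)
  show "(0, v) \<in> topspace (prism_space q)" using v by simp
  let ?D = "prod_topology interval_space (prism_space q)"
  have u: "continuous_map ?D euclideanreal (\<lambda>z. fst z)"
    using continuous_map_into_fulltopology[OF continuous_map_fst] by blast
  have p: "continuous_map ?D (prism_space q) snd" by (rule continuous_map_snd)
  have s: "continuous_map ?D euclideanreal (\<lambda>z. fst (snd z))"
    using continuous_map_compose[OF p[unfolded prism_space_def] continuous_map_fst]
    unfolding prism_space_def by (simp add: o_def continuous_map_in_subtopology)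
  have x: "continuous_map ?D (powertop_real UNIV) (\<lambda>z. snd (snd z))"
    using continuous_map_compose[OF p[unfolded prism_space_def] continuous_map_snd]
    unfolding prism_space_def by (simp add: o_def continuous_map_in_subtopology)
  have xi: "continuous_map ?D euclideanreal (\<lambda>z. snd (snd z) i)" for i
    using continuous_map_compose[OF x continuous_map_product_projection[of i UNIV "\<lambda>_. euclideanreal"]]
    by (simp add: o_def)
  have u1: "continuous_map ?D euclideanreal (\<lambda>z. 1 - fst z)"
    by (intro continuous_map_diff u) simp
  have c1: "continuous_map ?D interval_space (\<lambda>z. (1 - fst z) * fst (snd z))"
    unfolding continuous_map_in_subtopology
    by (auto intro!: continuous_map_real_mult u1 s mult_le_one)
  have c2: "continuous_map ?D (simplex_space q) (\<lambda>z i. (1 - fst z) * snd (snd z) i + fst z * v i)"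
    unfolding continuous_map_in_subtopology
    by (auto intro!: continuous_map_add continuous_map_real_mult u u1 xi
        convex_standard_simplex v simp: continuous_map_componentwise_UNIV)
  have "continuous_map ?D (prism_space q) h"
    using c1 c2 unfolding prism_space_def h_def
    by (simp add: continuous_map_pairwise o_def case_prod_unfold)
  then show "homotopic_with (\<lambda>h. h \<in> {} \<rightarrow> {}) (prism_space q) (prism_space q) id (\<lambda>_. (0, v))"
    unfolding homotopic_with_def by (intro exI[of _ h]) (auto simp: h_def)
qed

text \<open>By contractibility \<open>z\<close> is homologous to its image under a constant map.
  That image bounds in a one-point space in positive degrees; in degree 0 the last assumption, that
  \<open>z\<close> has augmentation 0, makes it vanish.\<close>

lemma prism_space_cycle_bounds:
  assumes z: "singular_chain n (prism_space q) z" "chain_boundary n z = 0"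
    and n: "n = 0 \<longrightarrow> (\<forall>a. chain_map n (\<lambda>_. a) z = (0 :: (real \<times> (nat \<Rightarrow> real)) chain))"
  obtains d where "singular_chain (Suc n) (prism_space q) d" "chain_boundary (Suc n) d = z"
proof -
  obtain a where a: "a \<in> topspace (prism_space q)"
    "homotopic_with (\<lambda>h. h \<in> {} \<rightarrow> {}) (prism_space q) (prism_space q) id (\<lambda>_. a)"
    using contract_prism_space by blast
  have cyc: "singular_relcycle n (prism_space q) {} z" using z by (simp add: singular_cycle)
  have 1: "singular_relboundary n (prism_space q) {} (z - chain_map n (\<lambda>_. a) z)"
    using homotopic_imp_homologous_rel_chain_maps[OF a(2) cyc] chain_map_ident[OF z(1)]
    by (simp add: homologous_rel_def)
  have 2: "singular_relboundary n (prism_space q) {} (chain_map n (\<lambda>_. a) z)"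
  proof (cases "n = 0")
    case False
    have top: "topspace (subtopology (prism_space q) {a}) = {a}"
      using a(1) by (simp only: topspace_subtopology) blast
    have "continuous_map (prism_space q) (subtopology (prism_space q) {a}) (\<lambda>_. a)"
      using a(1) by (auto simp: continuous_map_in_subtopology simp del: topspace_prism_space)
    then have "singular_relcycle n (subtopology (prism_space q) {a}) {} (chain_map n (\<lambda>_. a) z)"
      by (rule singular_relcycle_chain_map[OF cyc]) simp
    then have "singular_relboundary n (subtopology (prism_space q) {a}) {} (chain_map n (\<lambda>_. a) z)"
      using singular_boundary_eq_cycle_singleton[OF top] False by simp
    then show ?thesis
      using singular_boundary_mono[of "{a}" UNIV n "prism_space q"] by simp
  next
    case True
    with n have "chain_map n (\<lambda>_. a) z = 0" by blast
    then show ?thesis by (simp only: singular_relboundary_0)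
  qed
  have "singular_relboundary n (prism_space q) {} z"
    using singular_relboundary_add[OF 1 2] by simp
  then show ?thesis using that by (auto simp: singular_boundary)
qed

lemma boundary_sweep:
  assumes p: "singular_chain (Suc q) (prism_space q) p"
    and b: "chain_boundary (Suc q) p = frag_of (prism_end q 1) - frag_of (prism_end q 0) - r"
  shows "chain_boundary (Suc q) (sweep q p \<Phi> f)
    = frag_of (simplex_map q (\<lambda>x. \<Phi> (1, x)) f) - frag_of (simplex_map q (\<lambda>x. \<Phi> (0, x)) f)
      - chain_map q (\<lambda>(s, x). \<Phi> (s, f x)) r"
proof -
  have "simplex_map q (\<lambda>(s, x). \<Phi> (s, f x)) (prism_end q s) = simplex_map q (\<lambda>x. \<Phi> (s, x)) f" for s
    by (auto simp: simplex_map_def prism_end_def restrict_def)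
  then show ?thesis
    unfolding sweep_def by (simp add: chain_boundary_chain_map[OF p] b chain_map_diff)
qed

text \<open>Each face of \<open>f\<close> is \<open>f\<close> composed with the corresponding face
  of the identity simplex. Hence the side walls built once over the model are carried to those over
  \<open>f\<close>.\<close>

lemma chain_map_sweep_faces:
  assumes p: "singular_chain (Suc n) (prism_space n) p"
  shows "chain_map (Suc n) (\<lambda>(s, x). \<Phi> (s, f x))
      (frag_extend (sweep n p (\<lambda>z. z)) (chain_boundary (Suc n) (frag_of (simplex_id (Suc n)))))
    = frag_extend (sweep n p \<Phi>) (chain_boundary (Suc n) (frag_of f))"
proof -
  let ?G = "\<lambda>(s, x). \<Phi> (s, f x)"
  have "chain_map (Suc n) ?G (sweep n p (\<lambda>z. z) (singular_face (Suc n) k (simplex_id (Suc n))))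
      = sweep n p \<Phi> (singular_face (Suc n) k f)" if k: "k \<le> Suc n" for k
  proof -
    let ?e = "singular_face (Suc n) k (simplex_id (Suc n))"
    have "chain_map (Suc n) ?G (sweep n p (\<lambda>z. z) ?e) = chain_map (Suc n) (?G \<circ> (\<lambda>(s, x). (s, ?e x))) p"
      by (simp add: sweep_def chain_map_compose)
    also have "\<dots> = chain_map (Suc n) (\<lambda>(s, x). \<Phi> (s, singular_face (Suc n) k f x)) p"
    proof (rule chain_map_eq[OF p])
      fix y assume "y \<in> topspace (prism_space n)"
      then obtain s x where y: "y = (s, x)" "x \<in> standard_simplex n" by auto
      then have "simplical_face k x \<in> standard_simplex (Suc n)"
        using simplical_face_in_standard_simplex[of "Suc n" k x] k by simp
      then show "(?G \<circ> (\<lambda>(s, x). (s, ?e x))) y = (case y of (s, x) \<Rightarrow> \<Phi> (s, singular_face (Suc n) k f x))"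
        using y by (simp add: singular_face_def simplex_id_def)
    qed
    finally show ?thesis by (simp add: sweep_def)
  qed
  then show ?thesis
    by (simp add: chain_boundary_of frag_extend_sum frag_extend_cmul chain_map_sum del: sum.atMost_Suc)
qed

lemma boundary_frag_extend_sweep:
  assumes "\<And>f. singular_simplex n X f \<Longrightarrow> chain_boundary (Suc n) (sweep n p (\<lambda>z. z) f)
      = frag_of (simplex_map n (Pair 1) f) - frag_of (simplex_map n (Pair 0) f)
        - frag_extend F (chain_boundary n (frag_of f))"
    and "singular_chain n X c"
  shows "chain_boundary (Suc n) (frag_extend (sweep n p (\<lambda>z. z)) c)
      = chain_map n (Pair 1) c - chain_map n (Pair 0) c - frag_extend F (chain_boundary n c)"
  using assms(2) unfolding singular_chain_def
  by (induction c rule: frag_induction)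
    (use assms(1) in \<open>auto simp: frag_extend_diff chain_boundary_diff chain_map_diff\<close>)

text \<open>Acyclic models: the prism chains are built by induction on the dimension from the
  contractibility of \<open>[0,1] \<times> \<Delta>\<^sub>q\<close>. The last clause of the invariant \<open>good\<close> in the proof
  is the part of the chain homotopy identity that makes the next obstruction a cycle.\<close>

lemma prism_chains_exist:
  obtains P where "\<And>q. singular_chain (Suc q) (prism_space q) (P q)"
    and "chain_boundary 1 (P 0) = frag_of (prism_end 0 1) - frag_of (prism_end 0 0)"
    and "\<And>q. chain_boundary (Suc (Suc q)) (P (Suc q))
      = frag_of (prism_end (Suc q) 1) - frag_of (prism_end (Suc q) 0)
        - frag_extend (sweep q (P q) (\<lambda>z. z)) (chain_boundary (Suc q) (frag_of (simplex_id (Suc q))))"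
proof -
  \<comment> \<open>The quantified spaces live on the model type only: the clause is applied to the
    boundary of the identity simplex.\<close>
  define good where "good n p \<longleftrightarrow> singular_chain (Suc n) (prism_space n) p \<and>
      (n = 0 \<longrightarrow> chain_boundary 1 p = frag_of (prism_end 0 1) - frag_of (prism_end 0 0)) \<and>
      (\<forall>(X :: (nat \<Rightarrow> real) topology) c. singular_chain n X c \<and> chain_boundary n c = 0 \<longrightarrow>
         chain_boundary (Suc n) (frag_extend (sweep n p (\<lambda>z. z)) c) = chain_map n (Pair 1) c - chain_map n (Pair 0) c)"
    for n p
  define link where "link n p p' \<longleftrightarrow> chain_boundary (Suc (Suc n)) p'
      = frag_of (prism_end (Suc n) 1) - frag_of (prism_end (Suc n) 0)
        - frag_extend (sweep n p (\<lambda>z. z)) (chain_boundary (Suc n) (frag_of (simplex_id (Suc n))))" for n p p'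
  have base: "\<exists>p. good 0 p"
  proof -
    let ?z = "frag_of (prism_end 0 1) - frag_of (prism_end 0 0)"
    obtain p where p: "singular_chain (Suc 0) (prism_space 0) p" "chain_boundary (Suc 0) p = ?z"
    proof (rule prism_space_cycle_bounds[of 0 0 ?z])
      show "singular_chain 0 (prism_space 0) ?z"
        by (intro singular_chain_diff) (simp_all add: singular_chain_of singular_simplex_prism_end)
      show "chain_boundary 0 ?z = 0" by (simp add: chain_boundary_def)
      \<comment> \<open>A constant map sends both ends to the same simplex, so their difference has
        augmentation 0.\<close>
      show "0 = 0 \<longrightarrow> (\<forall>a. chain_map 0 (\<lambda>_. a) ?z = (0 :: (real \<times> (nat \<Rightarrow> real)) chain))"
        by (simp add: chain_map_diff simplex_map_def o_def)
    qed
    have "chain_boundary (Suc 0) (frag_extend (sweep 0 p (\<lambda>z. z)) c) = chain_map 0 (Pair 1) c - chain_map 0 (Pair 0) c"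
      if c: "singular_chain 0 X c" for X :: "(nat \<Rightarrow> real) topology" and c
    proof -
      have "chain_boundary (Suc 0) (sweep 0 p (\<lambda>z. z) f)
        = frag_of (simplex_map 0 (Pair 1) f) - frag_of (simplex_map 0 (Pair 0) f)
          - frag_extend (\<lambda>_. 0) (chain_boundary 0 (frag_of f))" for f :: "(nat \<Rightarrow> real) \<Rightarrow> nat \<Rightarrow> real"
        using boundary_sweep[of 0 p 0 "\<lambda>z. z" f] p by (simp add: chain_boundary_def)
      from boundary_frag_extend_sweep[OF this c] show ?thesis by (simp add: chain_boundary_def)
    qed
    then have "good 0 p" unfolding good_def One_nat_def using p by blast
    then show ?thesis by blast
  qed
  have step: "\<exists>p'. good (Suc n) p' \<and> link n p p'" if gd: "good n p" for n p
  proof -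
    let ?\<iota> = "frag_of (simplex_id (Suc n))"
    let ?r = "frag_extend (sweep n p (\<lambda>z. z)) (chain_boundary (Suc n) ?\<iota>)"
    let ?z = "frag_of (prism_end (Suc n) 1) - frag_of (prism_end (Suc n) 0) - ?r"
    have p: "singular_chain (Suc n) (prism_space n) p" using gd by (simp add: good_def)
    have \<iota>: "singular_chain (Suc n) (simplex_space (Suc n)) ?\<iota>"
      by (simp add: singular_chain_of singular_simplex_id)
    have d\<iota>: "singular_chain n (simplex_space (Suc n)) (chain_boundary (Suc n) ?\<iota>)"
      using singular_chain_boundary_alt[OF \<iota>] .
    have ends: "frag_of (prism_end (Suc n) s) = chain_map (Suc n) (Pair s) ?\<iota>" for s
    proof -
      have "simplex_map (Suc n) (Pair s) (simplex_id (Suc n)) = prism_end (Suc n) s"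
        by (auto simp: simplex_map_def prism_end_def simplex_id_def)
      then show ?thesis by simp
    qed
    have dends: "chain_boundary (Suc n) (frag_of (prism_end (Suc n) s)) = chain_map n (Pair s) (chain_boundary (Suc n) ?\<iota>)" for s
      unfolding ends using chain_boundary_chain_map[OF \<iota>, of "Pair s"] by (simp only: diff_Suc_1 One_nat_def[symmetric])
    \<comment> \<open>The boundary of the identity simplex is itself a cycle, so the last clause of
      \<open>good\<close> applies; it makes the side walls cancel the boundaries of the two
      ends.\<close>
    have dr: "chain_boundary (Suc n) ?r
        = chain_map n (Pair 1) (chain_boundary (Suc n) ?\<iota>) - chain_map n (Pair 0) (chain_boundary (Suc n) ?\<iota>)"
      using gd d\<iota> chain_boundary_boundary_alt[OF \<iota>] unfolding good_def by blast
    obtain p' where p': "singular_chain (Suc (Suc n)) (prism_space (Suc n)) p'" "chain_boundary (Suc (Suc n)) p' = ?z"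
    proof (rule prism_space_cycle_bounds[of "Suc n" "Suc n" ?z])
      have "singular_chain (Suc n) (prism_space (Suc n)) ?r"
      proof (rule singular_chain_extend)
        fix f assume "f \<in> Poly_Mapping.keys (chain_boundary (Suc n) ?\<iota>)"
        then have "singular_simplex n (simplex_space (Suc n)) f"
          using d\<iota> by (auto simp: singular_chain_def)
        then show "singular_chain (Suc n) (prism_space (Suc n)) (sweep n p (\<lambda>z. z) f)"
          by (rule singular_chain_sweep[OF p]) (simp add: prism_space_def)
      qed
      then show "singular_chain (Suc n) (prism_space (Suc n)) ?z"
        by (intro singular_chain_diff) (simp_all add: singular_chain_of singular_simplex_prism_end)
      show "chain_boundary (Suc n) ?z = 0"
        by (simp only: chain_boundary_diff dends dr) simp
    qed simp
    have "chain_boundary (Suc (Suc n)) (frag_extend (sweep (Suc n) p' (\<lambda>z. z)) c)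
        = chain_map (Suc n) (Pair 1) c - chain_map (Suc n) (Pair 0) c - frag_extend (sweep n p (\<lambda>z. z)) (chain_boundary (Suc n) c)"
      if c: "singular_chain (Suc n) X c" for X :: "(nat \<Rightarrow> real) topology" and c :: "(nat \<Rightarrow> real) chain"
    proof (rule boundary_frag_extend_sweep[OF _ c])
      fix f :: "(nat \<Rightarrow> real) \<Rightarrow> nat \<Rightarrow> real"
      show "chain_boundary (Suc (Suc n)) (sweep (Suc n) p' (\<lambda>z. z) f)
        = frag_of (simplex_map (Suc n) (Pair 1) f) - frag_of (simplex_map (Suc n) (Pair 0) f)
          - frag_extend (sweep n p (\<lambda>z. z)) (chain_boundary (Suc n) (frag_of f))"
        using boundary_sweep[OF p', of "\<lambda>z. z" f] chain_map_sweep_faces[OF p, of "\<lambda>z. z" f] by simp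
    qed
    then have "chain_boundary (Suc (Suc n)) (frag_extend (sweep (Suc n) p' (\<lambda>z. z)) c)
        = chain_map (Suc n) (Pair 1) c - chain_map (Suc n) (Pair 0) c"
      if "singular_chain (Suc n) X c" "chain_boundary (Suc n) c = 0"
      for X :: "(nat \<Rightarrow> real) topology" and c :: "(nat \<Rightarrow> real) chain"
      using that by fastforce
    then have "good (Suc n) p'" unfolding good_def using p'(1) by blast
    moreover have "link n p p'" using p'(2) by (simp add: link_def)
    ultimately show ?thesis by blast
  qed
  obtain P where "\<forall>n. good n (P n) \<and> link n (P n) (P (Suc n))"
    using dependent_nat_choice[of good link, OF base step] by blast
  then show thesis using that[of P] by (auto simp: good_def link_def)
qed

section \<open>Pushforward of chains and the homotopy formula\<close>

definition coeff_push :: "nat \<Rightarrow> ('a \<Rightarrow> 'b) \<Rightarrow> ('a, 'g::ab_group_add) gchain \<Rightarrow> ('b, 'g) gchain" where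
  "coeff_push q h = chain_lift (\<lambda>f. frag_of (simplex_map q h f))"

lemma coeff_push_diff: "coeff_push q h (c - d) = coeff_push q h c - coeff_push q h d"
  by (simp add: coeff_push_def chain_lift_diff)

lemma coeff_chain_push:
  assumes "coeff_chain q X c" "\<And>f. f \<in> Poly_Mapping.keys c \<Longrightarrow> singular_simplex q Y (simplex_map q h f)"
  shows "coeff_chain q Y (coeff_push q h c)"
  unfolding coeff_push_def using assms by (intro coeff_chain_lift) (auto simp: singular_chain_of)

lemma coeff_push_boundary:
  assumes "coeff_chain q X c"
  shows "coeff_boundary q (coeff_push q h c) = coeff_push (q - 1) h (coeff_boundary q c)"
proof -
  have "coeff_boundary q (coeff_push q h c) = chain_lift (\<lambda>f. chain_boundary q (chain_map q h (frag_of f))) c"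
    by (simp add: coeff_push_def coeff_boundary_lift)
  also have "\<dots> = chain_lift (\<lambda>f. chain_map (q - 1) h (chain_boundary q (frag_of f))) c"
  proof (rule chain_lift_cong)
    fix f assume "f \<in> Poly_Mapping.keys c"
    then have "singular_chain q X (frag_of f)" using assms by (auto simp: coeff_chain_def singular_chain_of)
    then show "chain_boundary q (chain_map q h (frag_of f)) = chain_map (q - 1) h (chain_boundary q (frag_of f))"
      using chain_boundary_chain_map by (metis One_nat_def)
  qed
  also have "\<dots> = coeff_push (q - 1) h (coeff_boundary q c)"
    by (simp add: coeff_push_def coeff_boundary_eq_lift chain_lift_comp chain_map_def o_def)
  finally show ?thesis .
qed

text \<open>The operator \<open>K\<close> depends only on \<open>\<Phi>\<close>, not on the space, so one \<open>K\<close> serves all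
  subspaces that are preserved by the homotopy.\<close>

lemma coeff_chain_homotopy:
  fixes \<Phi> :: "real \<times> 'a \<Rightarrow> 'b"
  obtains K :: "nat \<Rightarrow> ('a, 'g::ab_group_add) gchain \<Rightarrow> ('b, 'g) gchain"
  where "\<And>q X Y c. \<lbrakk>coeff_chain q X c; continuous_map (prod_topology interval_space X) Y \<Phi>\<rbrakk>
      \<Longrightarrow> coeff_chain (Suc q) Y (K q c)"
    and "\<And>q. K q 0 = 0"
    and "\<And>q X c. coeff_chain q X c \<Longrightarrow> coeff_boundary (Suc q) (K q c)
      = coeff_push q (\<lambda>x. \<Phi> (1, x)) c - coeff_push q (\<lambda>x. \<Phi> (0, x)) c - K (q - 1) (coeff_boundary q c)"
proof -
  obtain P where P: "\<And>q. singular_chain (Suc q) (prism_space q) (P q)"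
    "chain_boundary 1 (P 0) = frag_of (prism_end 0 1) - frag_of (prism_end 0 0)"
    "\<And>q. chain_boundary (Suc (Suc q)) (P (Suc q))
      = frag_of (prism_end (Suc q) 1) - frag_of (prism_end (Suc q) 0)
        - frag_extend (sweep q (P q) (\<lambda>z. z)) (chain_boundary (Suc q) (frag_of (simplex_id (Suc q))))"
    using prism_chains_exist by blast
  define H where "H q = sweep q (P q) \<Phi>" for q
  \<comment> \<open>For \<open>q = 0\<close> the term with \<open>H (q - 1)\<close> is applied to a
    zero boundary, so the truncated index does not matter.\<close>
  have bH: "chain_boundary (Suc q) (H q f)
      = frag_of (simplex_map q (\<lambda>x. \<Phi> (1, x)) f) - frag_of (simplex_map q (\<lambda>x. \<Phi> (0, x)) f)
        - frag_extend (H (q - 1)) (chain_boundary q (frag_of f))" for q f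
  proof (cases q)
    case 0
    then show ?thesis using boundary_sweep[of 0 "P 0" 0 \<Phi> f] P(1)[of 0] P(2)
      by (simp add: H_def chain_boundary_def)
  next
    case (Suc n)
    then show ?thesis
      using boundary_sweep[OF P(1) P(3), of n \<Phi> f] chain_map_sweep_faces[OF P(1), of n \<Phi> f]
      by (simp add: H_def)
  qed
  show thesis
  proof
    fix q X Y and c :: "('a, 'g) gchain"
    assume "coeff_chain q X c" "continuous_map (prod_topology interval_space X) Y \<Phi>"
    then show "coeff_chain (Suc q) Y (chain_lift (H q) c)"
      unfolding H_def by (intro coeff_chain_lift singular_chain_sweep[OF P(1)]) (auto simp: coeff_chain_def)
  next
    fix q X and c :: "('a, 'g) gchain"
    assume "coeff_chain q X c"
    have "coeff_boundary (Suc q) (chain_lift (H q) c) = chain_lift (\<lambda>f. chain_boundary (Suc q) (H q f)) c"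
      by (rule coeff_boundary_lift)
    also have "\<dots> = coeff_push q (\<lambda>x. \<Phi> (1, x)) c - coeff_push q (\<lambda>x. \<Phi> (0, x)) c
        - chain_lift (H (q - 1)) (coeff_boundary q c)"
      unfolding bH chain_lift_fun_diff by (simp add: coeff_push_def coeff_boundary_eq_lift chain_lift_comp)
    finally show "coeff_boundary (Suc q) (chain_lift (H q) c)
      = coeff_push q (\<lambda>x. \<Phi> (1, x)) c - coeff_push q (\<lambda>x. \<Phi> (0, x)) c
        - chain_lift (H (q - 1)) (coeff_boundary q c)" .
  qed simp
qed

text \<open>The chain \<open>K q c\<close> bounds the difference up to the operator applied to the
  boundary of \<open>c\<close>. That boundary lies in \<open>Q\<close>, and the homotopy preserves
  \<open>Q\<close>, so the error vanishes relative to \<open>Q\<close>.\<close>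

lemma homotopic_push_rel_boundary:
  fixes \<Phi> :: "real \<times> 'a::topological_space \<Rightarrow> 'a" and c :: "('a, 'g::ab_group_add) gchain"
  assumes c: "c \<in> rel_cycles q P Q"
    and \<Phi>P: "continuous_map (prod_topology interval_space (top_of_set P)) (top_of_set P) \<Phi>"
    and \<Phi>Q: "continuous_map (prod_topology interval_space (top_of_set Q)) (top_of_set Q) \<Phi>"
    and 0: "\<And>x. x \<in> P \<Longrightarrow> \<Phi> (0, x) = x"
  shows "coeff_push q (\<lambda>x. \<Phi> (1, x)) c - c \<in> rel_boundaries q P Q"
proof -
  have cP: "coeff_chain q (top_of_set P) c" "coeff_chain (q - 1) (top_of_set Q) (coeff_boundary q c)"
    using c by (auto simp: rel_cycles_def)
  obtain K :: "nat \<Rightarrow> ('a, 'g) gchain \<Rightarrow> ('a, 'g) gchain" where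
    K: "\<And>q X Y c. \<lbrakk>coeff_chain q X c; continuous_map (prod_topology interval_space X) Y \<Phi>\<rbrakk>
      \<Longrightarrow> coeff_chain (Suc q) Y (K q c)"
    and K0: "\<And>q. K q 0 = 0"
    and bK: "\<And>q X c. coeff_chain q X c \<Longrightarrow> coeff_boundary (Suc q) (K q c)
      = coeff_push q (\<lambda>x. \<Phi> (1, x)) c - coeff_push q (\<lambda>x. \<Phi> (0, x)) c - K (q - 1) (coeff_boundary q c)"
    using coeff_chain_homotopy[of \<Phi>] by blast
  have "coeff_push q (\<lambda>x. \<Phi> (0, x)) c = chain_lift frag_of c"
    unfolding coeff_push_def
  proof (rule chain_lift_cong)
    fix f assume "f \<in> Poly_Mapping.keys c"
    then have "singular_simplex q (top_of_set P) f" using cP(1) by (auto simp: coeff_chain_def)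
    then have "simplex_map q (\<lambda>x. \<Phi> (0, x)) f = f" by (rule simplex_map_id_gen) (simp add: 0)
    then show "frag_of (simplex_map q (\<lambda>x. \<Phi> (0, x)) f) = frag_of f" by simp
  qed
  then have e: "coeff_boundary (Suc q) (K q c) - (coeff_push q (\<lambda>x. \<Phi> (1, x)) c - c)
      = - K (q - 1) (coeff_boundary q c)"
    using bK[OF cP(1)] by simp
  have "K (q - 1) (coeff_boundary q c) \<in> coeff_chains q Q"
  proof (cases q)
    case 0 then show ?thesis by (simp add: K0)
  next
    case (Suc n) then show ?thesis using K[OF cP(2) \<Phi>Q] by simp
  qed
  then have "- K (q - 1) (coeff_boundary q c) \<in> coeff_chains q Q"
    by (rule add_subgroup_uminus[OF add_subgroup_coeff_chain])
  moreover have "K q c \<in> coeff_chains (Suc q) P" using K[OF cP(1) \<Phi>P] by simp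
  ultimately show ?thesis using e by (metis rel_boundariesI)
qed

section \<open>Absorption of chains by a semiflow\<close>

lemma continuous_on_semiflow:
  assumes "semiflow S" "0 \<le> t"
  shows "continuous_on X (S t)"
proof -
  have "continuous_on X ((\<lambda>(t, x). S t x) \<circ> (\<lambda>x. (t, x)))"
  proof (rule continuous_on_compose)
    have "Pair t ` X \<subseteq> {0..} \<times> UNIV" using assms(2) by auto
    then show "continuous_on (Pair t ` X) (\<lambda>(t, x). S t x)"
      using assms(1) continuous_on_subset unfolding semiflow_def by blast
  qed (intro continuous_intros)
  then show ?thesis by (simp add: o_def)
qed

text \<open>A chain has compact support, so a semiflow under which compact subsets of the larger pair
  eventually enter the smaller one pushes every chain of the larger pair into the smaller one.\<close>

lemma absorbing_pair_rank_eq: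
  fixes S :: "real \<Rightarrow> 'a::metric_space \<Rightarrow> 'a"
  assumes S: "semiflow S"
    and sub: "Q \<subseteq> P" "P \<subseteq> P'" "Q \<subseteq> Q'" "Q' \<subseteq> P'"
    and inv: "\<And>t x. 0 \<le> t \<Longrightarrow> x \<in> P \<Longrightarrow> S t x \<in> P" "\<And>t x. 0 \<le> t \<Longrightarrow> x \<in> Q \<Longrightarrow> S t x \<in> Q"
      "\<And>t x. 0 \<le> t \<Longrightarrow> x \<in> P' \<Longrightarrow> S t x \<in> P'" "\<And>t x. 0 \<le> t \<Longrightarrow> x \<in> Q' \<Longrightarrow> S t x \<in> Q'"
    and absP: "\<And>K. compact K \<Longrightarrow> K \<subseteq> P' \<Longrightarrow> \<exists>T\<ge>0. S T ` K \<subseteq> P"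
    and absQ: "\<And>K. compact K \<Longrightarrow> K \<subseteq> Q' \<Longrightarrow> \<exists>T\<ge>0. S T ` K \<subseteq> Q"
  shows "quotient_rank (rel_cycles q P Q :: ('a, 'g::ab_group_add) gchain set) (rel_boundaries q P Q)
    = quotient_rank (rel_cycles q P' Q' :: ('a, 'g) gchain set) (rel_boundaries q P' Q')"
proof -
  have S0: "S 0 x = x" and Sadd: "0 \<le> t \<Longrightarrow> 0 \<le> s \<Longrightarrow> S (t + s) x = S t (S s x)" for t s x
    using S by (auto simp: semiflow_def)
  \<comment> \<open>Rescaling time by \<open>T\<close> turns the flow into a homotopy over the unit
    interval from the identity to \<open>S T\<close>.\<close>
  have cont: "continuous_map (prod_topology interval_space (top_of_set A)) (top_of_set A) (\<lambda>(s, x). S (s * T) x)"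
    if "0 \<le> T" and A: "\<And>t x. 0 \<le> t \<Longrightarrow> x \<in> A \<Longrightarrow> S t x \<in> A" for T A
  proof -
    have "continuous_on ({0..1} \<times> A) ((\<lambda>(t, x). S t x) \<circ> (\<lambda>(s, x). (s * T, x)))"
    proof (rule continuous_on_compose)
      show "continuous_on ({0..1} \<times> A) (\<lambda>(s, x). (s * T, x))"
        by (auto simp: case_prod_unfold intro!: continuous_intros)
      have "(\<lambda>(s, x). (s * T, x)) ` ({0..1} \<times> A) \<subseteq> {0..} \<times> UNIV" using that by auto
      then show "continuous_on ((\<lambda>(s, x). (s * T, x)) ` ({0..1} \<times> A)) (\<lambda>(t, x). S t x)"
        using S continuous_on_subset unfolding semiflow_def by blast
    qed
    then show ?thesis
      using that by (auto simp: continuous_map_in_subtopology case_prod_unfold o_def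
          subtopology_Times[symmetric] euclidean_product_topology simp flip: continuous_map_iff_continuous)
  qed
  have contS: "continuous_map (top_of_set A) euclidean (S T)" if "0 \<le> T" for T A
    using continuous_on_semiflow[OF S that] by simp
  \<comment> \<open>Forward invariance keeps the chain in \<open>A\<close> at all later times, so
    two absorbing times can be replaced by their maximum.\<close>
  have push: "\<exists>T\<ge>0. \<forall>t\<ge>T. coeff_push n (S t) c \<in> coeff_chains n A"
    if c: "c \<in> coeff_chains n A'" and A: "\<And>t x. 0 \<le> t \<Longrightarrow> x \<in> A \<Longrightarrow> S t x \<in> A"
      and abs: "\<And>K. compact K \<Longrightarrow> K \<subseteq> A' \<Longrightarrow> \<exists>T\<ge>0. S T ` K \<subseteq> A"
    for n A A' and c :: "('a, 'g) gchain"
  proof -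
    let ?K = "\<Union>f\<in>Poly_Mapping.keys c. f ` standard_simplex n"
    have sc: "singular_simplex n (top_of_set A') f" if "f \<in> Poly_Mapping.keys c" for f
      using c that by (auto simp: coeff_chain_def)
    have "compactin (top_of_set A') (f ` standard_simplex n)" if "f \<in> Poly_Mapping.keys c" for f
      using sc[OF that] unfolding singular_simplex_def
      by (intro image_compactin[of "simplex_space n"])
        (auto simp: compactin_subtopology compactin_standard_simplex)
    then have *: "compact (f ` standard_simplex n)" "f ` standard_simplex n \<subseteq> A'" if "f \<in> Poly_Mapping.keys c" for f
      using that by (auto simp: compactin_subtopology)
    then have "compact ?K" "?K \<subseteq> A'" by (auto intro!: compact_UN)
    then obtain T where T: "T \<ge> 0" "S T ` ?K \<subseteq> A" using abs by blast
    have "coeff_push n (S t) c \<in> coeff_chains n A" if "t \<ge> T" for t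
    proof -
      have t0: "0 \<le> t" using T(1) that by simp
      have StA: "S t x \<in> A" if "x \<in> ?K" for x
      proof -
        have "S t x = S (t - T) (S T x)" using Sadd[of "t - T" T x] T(1) \<open>t \<ge> T\<close> by simp
        moreover have "S T x \<in> A" using T(2) that by blast
        ultimately show ?thesis using A \<open>t \<ge> T\<close> by simp
      qed
      have "singular_simplex n (top_of_set A) (simplex_map n (S t) f)" if f: "f \<in> Poly_Mapping.keys c" for f
      proof -
        have "singular_simplex n euclidean (simplex_map n (S t) f)"
          by (rule singular_simplex_simplex_map[OF sc[OF f] contS[OF t0]])
        moreover have "simplex_map n (S t) f ` standard_simplex n \<subseteq> A"
          using StA f by (auto simp: simplex_map_def)
        ultimately show ?thesis by (simp add: singular_simplex_subtopology)
      qed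
      then show ?thesis using c by (auto intro: coeff_chain_push)
    qed
    then show ?thesis using T by blast
  qed
  have homot: "coeff_push q (S T) c - c \<in> rel_boundaries q A B"
    if "0 \<le> T" "c \<in> rel_cycles q A B" and "\<And>t x. 0 \<le> t \<Longrightarrow> x \<in> A \<Longrightarrow> S t x \<in> A" "\<And>t x. 0 \<le> t \<Longrightarrow> x \<in> B \<Longrightarrow> S t x \<in> B"
    for T A B and c :: "('a, 'g) gchain"
    using homotopic_push_rel_boundary[OF that(2) cont[OF that(1,3)] cont[OF that(1,4)]] S0 by simp
  have mono: "rel_cycles q P Q \<subseteq> (rel_cycles q P' Q' :: ('a, 'g) gchain set)"
    using coeff_chains_mono[OF sub(2)] coeff_chains_mono[OF sub(3)] unfolding rel_cycles_def by blast
  have monoB: "rel_boundaries q P Q \<subseteq> (rel_boundaries q P' Q' :: ('a, 'g) gchain set)"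
    using coeff_chains_mono[OF sub(2)] coeff_chains_mono[OF sub(3)] unfolding rel_boundaries_def by blast
  show ?thesis
  proof (rule quotient_rank_eq_of_map[of "\<lambda>c. c"])
    fix c :: "('a, 'g) gchain" assume c: "c \<in> rel_cycles q P Q"
    show "c \<in> rel_boundaries q P' Q' \<longleftrightarrow> c \<in> rel_boundaries q P Q"
    proof
      \<comment> \<open>Injectivity: the flow carries the bounding chain into the smaller pair,
        where the pushed cycle is still homologous to \<open>c\<close>.\<close>
      assume "c \<in> rel_boundaries q P' Q'"
      then obtain d where d: "d \<in> coeff_chains (Suc q) P'" "coeff_boundary (Suc q) d - c \<in> coeff_chains q Q'"
        by (auto simp: rel_boundaries_def)
      obtain T1 where T1: "T1 \<ge> 0" "\<forall>t\<ge>T1. coeff_push (Suc q) (S t) d \<in> coeff_chains (Suc q) P"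
        using push[OF d(1) inv(1) absP] by blast
      obtain T2 where T2: "T2 \<ge> 0" "\<forall>t\<ge>T2. coeff_push q (S t) (coeff_boundary (Suc q) d - c) \<in> coeff_chains q Q"
        using push[OF d(2) inv(2) absQ] by blast
      define T where "T = max T1 T2"
      have "coeff_push q (S T) c \<in> rel_boundaries q P Q"
      proof (rule rel_boundariesI)
        show "coeff_push (Suc q) (S T) d \<in> coeff_chains (Suc q) P" using T1 by (simp add: T_def)
        have "coeff_boundary (Suc q) (coeff_push (Suc q) (S T) d) = coeff_push q (S T) (coeff_boundary (Suc q) d)"
          using coeff_push_boundary[of "Suc q" "top_of_set P'" d "S T"] d(1) by simp
        then show "coeff_boundary (Suc q) (coeff_push (Suc q) (S T) d) - coeff_push q (S T) c \<in> coeff_chains q Q"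
          using T2(2)[rule_format, of T] by (simp add: T_def coeff_push_diff)
      qed
      moreover have "coeff_push q (S T) c - c \<in> rel_boundaries q P Q"
        using T1(1) by (intro homot c inv) (auto simp: T_def)
      ultimately have "coeff_push q (S T) c - (coeff_push q (S T) c - c) \<in> rel_boundaries q P Q"
        by (rule add_subgroup_diff[OF add_subgroup_rel_boundaries])
      then show "c \<in> rel_boundaries q P Q" by simp
    qed (use monoB in blast)
  next
    fix c :: "('a, 'g) gchain" assume c: "c \<in> rel_cycles q P' Q'"
    then have c1: "c \<in> coeff_chains q P'" and c2: "coeff_boundary q c \<in> coeff_chains (q - 1) Q'"
      by (auto simp: rel_cycles_def)
    obtain T1 where T1: "T1 \<ge> 0" "\<forall>t\<ge>T1. coeff_push q (S t) c \<in> coeff_chains q P"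
      using push[OF c1 inv(1) absP] by blast
    obtain T2 where T2: "T2 \<ge> 0" "\<forall>t\<ge>T2. coeff_push (q - 1) (S t) (coeff_boundary q c) \<in> coeff_chains (q - 1) Q"
      using push[OF c2 inv(2) absQ] by blast
    define T where "T = max T1 T2"
    \<comment> \<open>Surjectivity: a cycle of the larger pair is homologous there to its pushed
      copy, which lies in the smaller pair.\<close>
    have "coeff_push q (S T) c \<in> rel_cycles q P Q"
      using T1 T2 coeff_push_boundary[of q "top_of_set P'" c "S T"] c1 by (simp add: rel_cycles_def T_def)
    moreover have "coeff_push q (S T) c - c \<in> rel_boundaries q P' Q'"
      using T1(1) by (intro homot c inv) (auto simp: T_def)
    ultimately show "\<exists>z\<in>rel_cycles q P Q. z - c \<in> rel_boundaries q P' Q'" by blast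
  next
    show "c \<in> rel_cycles q P' Q'" if "c \<in> rel_cycles q P Q" for c :: "('a, 'g) gchain"
      using that mono by blast
  qed (simp_all add: add_subgroup_rel_cycles add_subgroup_rel_boundaries rel_boundaries_subset_cycles[OF sub(1)])
qed

section \<open>Sublevel sets of Morse-Lyapunov functions\<close>

locale morse_setting =
  fixes S :: "real \<Rightarrow> 'a::metric_space \<Rightarrow> 'a" and \<A> :: "'a set" and l :: nat and M :: "nat \<Rightarrow> 'a set"
  assumes semiflow: "semiflow S"
    and attractor: "attractor S \<A>"
    and decomposition: "morse_decomposition S \<A> l M"
begin

abbreviation basin :: "'a set" where "basin \<equiv> attraction_basin S \<A>"

lemma S_0 [simp]: "S 0 x = x"
  and S_add: "0 \<le> t \<Longrightarrow> 0 \<le> s \<Longrightarrow> S (t + s) x = S t (S s x)"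
  using semiflow by (auto simp: semiflow_def)

lemma attractor_invariant: "0 \<le> t \<Longrightarrow> x \<in> \<A> \<Longrightarrow> S t x \<in> \<A>"
  using attractor unfolding attractor_in_def flow_invariant_def by blast

lemma attractor_subset_basin: "\<A> \<subseteq> basin"
proof
  fix x assume x: "x \<in> \<A>"
  have "eventually (\<lambda>t. infdist (S t x) \<A> = 0) at_top"
    using eventually_ge_at_top[of 0] by eventually_elim (simp add: attractor_invariant x)
  then have "((\<lambda>t. infdist (S t x) \<A>) \<longlongrightarrow> 0) at_top" by (rule tendsto_eventually)
  then show "x \<in> basin" using x by (auto simp: attraction_basin_def)
qed

lemma basin_invariant:
  assumes "0 \<le> s" "x \<in> basin"
  shows "S s x \<in> basin"
proof -
  have lim: "((\<lambda>t. infdist (S t x) \<A>) \<longlongrightarrow> 0) at_top" and ne: "\<A> \<noteq> {}"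
    using assms by (auto simp: attraction_basin_def)
  have "((\<lambda>t. infdist (S (t + s) x) \<A>) \<longlongrightarrow> 0) at_top"
    using filterlim_compose[OF lim filterlim_tendsto_add_at_top[OF tendsto_const filterlim_ident, of s]]
    by (simp add: add.commute)
  moreover have "eventually (\<lambda>t. infdist (S (t + s) x) \<A> = infdist (S t (S s x)) \<A>) at_top"
    using eventually_ge_at_top[of 0] by eventually_elim (simp add: S_add assms)
  ultimately have "((\<lambda>t. infdist (S t (S s x)) \<A>) \<longlongrightarrow> 0) at_top"
    by (rule Lim_transform_eventually)
  then show ?thesis using ne by (auto simp: attraction_basin_def)
qed

lemma omega_limit_forward:
  assumes "0 \<le> s" "y \<in> omega_limit S x"
  shows "S s y \<in> omega_limit S x"
proof -
  obtain t where t: "\<forall>n. 0 \<le> t n" "filterlim t at_top sequentially" "(\<lambda>n. S (t n) x) \<longlonglongrightarrow> y"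
    using assms by (auto simp: omega_limit_def)
  have "(\<lambda>n. S s (S (t n) x)) \<longlonglongrightarrow> S s y"
    using continuous_on_semiflow[OF semiflow assms(1), of UNIV] t(3) by (auto intro: continuous_on_tendsto_compose)
  then have "(\<lambda>n. S (s + t n) x) \<longlonglongrightarrow> S s y" using S_add assms t(1) by simp
  moreover have "filterlim (\<lambda>n. s + t n) at_top sequentially"
    using filterlim_tendsto_add_at_top[OF tendsto_const t(2)] .
  ultimately show ?thesis
    using assms t(1) by (auto simp: omega_limit_def intro!: exI[of _ "\<lambda>n. s + t n"])
qed

lemma omega_limit_of_forward:
  assumes "0 \<le> s"
  shows "omega_limit S (S s x) \<subseteq> omega_limit S x"
proof
  fix y assume "y \<in> omega_limit S (S s x)"
  then obtain t where t: "\<forall>n. 0 \<le> t n" "filterlim t at_top sequentially" "(\<lambda>n. S (t n) (S s x)) \<longlonglongrightarrow> y"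
    by (auto simp: omega_limit_def)
  have "(\<lambda>n. S (t n + s) x) \<longlonglongrightarrow> y" using t(1,3) assms by (simp add: S_add)
  moreover have "filterlim (\<lambda>n. t n + s) at_top sequentially"
    using filterlim_tendsto_add_at_top[OF tendsto_const t(2), of s] by (simp add: add.commute)
  ultimately show "y \<in> omega_limit S x"
    using assms t(1) by (auto simp: omega_limit_def intro!: exI[of _ "\<lambda>n. t n + s"])
qed

lemma morse_set_subset: "j \<in> {1..l} \<Longrightarrow> M j \<subseteq> \<A>"
  using decomposition unfolding morse_decomposition_def dual_repeller_def by blast

lemma morse_set_invariant:
  assumes "j \<in> {1..l}" "0 \<le> t" "x \<in> M j"
  shows "S t x \<in> M j"
proof -
  obtain A where A: "\<forall>k\<le>l. attractor_in \<A> S (A k)" "\<forall>k\<in>{1..l}. M k = A k \<inter> dual_repeller S \<A> (A (k - 1))"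
    using decomposition unfolding morse_decomposition_def by blast
  have Mj: "M j = A j \<inter> dual_repeller S \<A> (A (j - 1))" using A(2) assms(1) by blast
  have "attractor_in \<A> S (A j)" using A(1) assms(1) by simp
  then have "S t ` A j = A j"
    using assms(2) unfolding attractor_in_def flow_invariant_def by blast
  then have "S t x \<in> A j" using Mj assms(3) by blast
  moreover have "S t x \<in> dual_repeller S \<A> (A (j - 1))"
    using assms(3) omega_limit_of_forward[OF assms(2), of x] attractor_invariant[OF assms(2)]
    unfolding Mj dual_repeller_def by blast
  ultimately show ?thesis using Mj by blast
qed

text \<open>The orbit is shadowed by points of the compact set \<A>. A convergent subsequence of
  these points drags the orbit along to the same limit.\<close>

lemma omega_limit_meets_attractor:
  assumes "x \<in> basin"
  obtains y where "y \<in> omega_limit S x" "y \<in> \<A>"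
proof -
  have lim: "((\<lambda>t. infdist (S t x) \<A>) \<longlongrightarrow> 0) at_top" and ne: "\<A> \<noteq> {}"
    using assms by (auto simp: attraction_basin_def)
  have lim': "(\<lambda>n. infdist (S (real n) x) \<A>) \<longlonglongrightarrow> 0"
    using filterlim_compose[OF lim filterlim_real_sequentially] .
  \<comment> \<open>The slack \<open>inverse (real (Suc n))\<close> avoids asking that the infimum
    be attained and still tends to 0.\<close>
  have "\<exists>a\<in>\<A>. dist (S (real n) x) a < infdist (S (real n) x) \<A> + inverse (real (Suc n))" for n
  proof -
    have "(INF a\<in>\<A>. dist (S (real n) x) a) < infdist (S (real n) x) \<A> + inverse (real (Suc n))"
      using ne by (simp add: infdist_def)
    then show ?thesis using ne by (subst (asm) cINF_less_iff) auto
  qed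
  then obtain a where a: "\<And>n. a n \<in> \<A>"
      "\<And>n. dist (S (real n) x) (a n) < infdist (S (real n) x) \<A> + inverse (real (Suc n))"
    by metis
  have "compact \<A>" using attractor by (simp add: attractor_in_def)
  then obtain y r where y: "y \<in> \<A>" "strict_mono r" "(a \<circ> r) \<longlonglongrightarrow> y"
    using a(1) unfolding compact_def by meson
  have "(\<lambda>n. infdist (S (real n) x) \<A> + inverse (real (Suc n))) \<longlonglongrightarrow> 0 + 0"
    by (intro tendsto_add lim' LIMSEQ_inverse_real_of_nat)
  then have upper: "(\<lambda>n. infdist (S (real n) x) \<A> + inverse (real (Suc n))) \<longlonglongrightarrow> 0" by simp
  have "(\<lambda>n. dist (S (real n) x) (a n)) \<longlonglongrightarrow> 0"
    by (rule tendsto_sandwich[OF always_eventually always_eventually tendsto_const upper])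
      (use a(2) less_imp_le in auto)
  from LIMSEQ_subseq_LIMSEQ[OF this y(2)] have d: "(\<lambda>n. dist (S (real (r n)) x) (a (r n))) \<longlonglongrightarrow> 0"
    by (simp add: o_def)
  have d': "(\<lambda>n. dist (a (r n)) y) \<longlonglongrightarrow> 0"
    using iffD1[OF tendsto_dist_iff y(3)] by (simp add: o_def)
  have "(\<lambda>n. dist (S (real (r n)) x) y) \<longlonglongrightarrow> 0"
    by (rule tendsto_sandwich[OF always_eventually always_eventually tendsto_const tendsto_add_zero[OF d d']])
      (simp_all add: dist_triangle)
  then have "(\<lambda>n. S (real (r n)) x) \<longlonglongrightarrow> y" by (rule iffD2[OF tendsto_dist_iff])
  moreover have "filterlim (\<lambda>n. real (r n)) at_top sequentially"
    using filterlim_compose[OF filterlim_real_sequentially filterlim_subseq[OF y(2)]] .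
  ultimately have "y \<in> omega_limit S x"
    by (auto simp: omega_limit_def intro!: exI[of _ "\<lambda>n. real (r n)"])
  then show thesis using that y(1) by blast
qed

definition morse_basin :: "nat \<Rightarrow> 'a set" where
  "morse_basin k = {x \<in> basin. \<exists>j\<in>{1..k}. omega_limit S x \<inter> M j \<noteq> {}}"

text \<open>The strict inequality makes this set relatively open in the basin, which the covering
  argument for compact subsets needs.\<close>

definition reaching :: "('a \<Rightarrow> real) \<Rightarrow> real \<Rightarrow> 'a set" where
  "reaching W c = {x \<in> basin. \<exists>t\<ge>0. W (S t x) < c}"

section \<open>Consequences of one Morse-Lyapunov function\<close>

context
  fixes W :: "'a \<Rightarrow> real"
  assumes W: "morse_lyapunov S basin l M W"
begin

lemma continuous_W: "continuous_on basin W"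
  using W by (simp add: morse_lyapunov_def)

lemma crit_value_eq: "j \<in> {1..l} \<Longrightarrow> y \<in> M j \<Longrightarrow> W y = crit_value W (M j)"
proof -
  assume j: "j \<in> {1..l}" and y: "y \<in> M j"
  then have "W constant_on M j" using W by (simp add: morse_lyapunov_def)
  then have "W ` M j = {W y}" using y by (auto simp: constant_on_def)
  then show ?thesis by (simp add: crit_value_def)
qed

lemma W_strict: "x \<in> basin \<Longrightarrow> x \<notin> (\<Union>k\<in>{1..l}. M k) \<Longrightarrow> 0 \<le> s \<Longrightarrow> s < t \<Longrightarrow> W (S t x) < W (S s x)"
  using W unfolding morse_lyapunov_def monotone_on_def by auto

lemma W_antimono:
  assumes "x \<in> basin" "0 \<le> s" "s \<le> t"
  shows "W (S t x) \<le> W (S s x)"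
proof (cases "x \<in> (\<Union>k\<in>{1..l}. M k)")
  case True
  then obtain j where j: "j \<in> {1..l}" "x \<in> M j" by blast
  then have "S t x \<in> M j" "S s x \<in> M j"
    using morse_set_invariant[OF j(1) _ j(2)] assms(2,3) by simp_all
  then have "W (S t x) = W (S s x)" using crit_value_eq[OF j(1)] by metis
  then show ?thesis by simp
next
  case False
  then show ?thesis using W_strict[OF assms(1) False assms(2)] assms(3) by (cases "s = t") (simp_all add: less_imp_le)
qed

text \<open>Along the orbit \<open>W\<close> is nonincreasing and, by continuity, converges to
  \<open>W y\<close> along a sequence of times. Thus \<open>W y\<close> is a lower bound that is
  approached arbitrarily closely.\<close>

lemma omega_limit_value:
  assumes x: "x \<in> basin" and y: "y \<in> omega_limit S x" "y \<in> basin"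
  shows "0 \<le> t \<Longrightarrow> W y \<le> W (S t x)" and "W y < c \<Longrightarrow> \<exists>t\<ge>0. W (S t x) < c"
proof -
  obtain r where r: "\<forall>n. 0 \<le> r n" "filterlim r at_top sequentially" "(\<lambda>n. S (r n) x) \<longlonglongrightarrow> y"
    using y(1) by (auto simp: omega_limit_def)
  have lim: "(\<lambda>n. W (S (r n) x)) \<longlonglongrightarrow> W y"
    by (rule continuous_on_tendsto_compose[OF continuous_W r(3) y(2)])
      (use basin_invariant x r(1) in auto)
  show "W y \<le> W (S t x)" if "0 \<le> t"
  proof (rule tendsto_upperbound[OF lim])
    have "eventually (\<lambda>n. t \<le> r n) sequentially" using r(2) by (simp add: filterlim_at_top)
    then show "eventually (\<lambda>n. W (S (r n) x) \<le> W (S t x)) sequentially"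
      by eventually_elim (use W_antimono[OF x that] in simp)
  qed simp
  show "\<exists>t\<ge>0. W (S t x) < c" if less: "W y < c"
  proof -
    obtain n where "W (S (r n) x) < c"
      using eventually_happens[OF order_tendstoD(2)[OF lim less]] by auto
    then show ?thesis using r(1) by blast
  qed
qed

text \<open>LaSalle's principle: for a limit point \<open>y\<close> outside all Morse sets,
  \<open>S 1 y\<close> would be a limit point of smaller value, and the orbit would drop below the
  lower bound \<open>W y\<close>.\<close>

lemma omega_limit_meets_morse_set:
  assumes x: "x \<in> basin"
  obtains j y where "j \<in> {1..l}" "y \<in> omega_limit S x" "y \<in> M j"
proof -
  obtain y where y: "y \<in> omega_limit S x" "y \<in> \<A>" using omega_limit_meets_attractor[OF x] .
  have y_basin: "y \<in> basin" using y attractor_subset_basin by blast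
  have "y \<in> (\<Union>k\<in>{1..l}. M k)"
  proof (rule ccontr)
    assume n: "y \<notin> (\<Union>k\<in>{1..l}. M k)"
    have "W (S 1 y) < W (S 0 y)" by (rule W_strict[OF y_basin n]) auto
    then have "W (S 1 y) < W y" by simp
    then obtain t where "t \<ge> 0" "W (S t x) < W y"
      using omega_limit_value(2)[OF x omega_limit_forward[OF zero_le_one y(1)] basin_invariant[OF zero_le_one y_basin]]
      by blast
    then show False using omega_limit_value(1)[OF x y(1) y_basin, of t] by linarith
  qed
  then show thesis using that y(1) by blast
qed

text \<open>The infimum of \<open>W\<close> along an orbit is the critical value of any Morse set
  that its limit set meets, and such a value is below \<open>c\<close> exactly for indices up to
  \<open>k\<close>.\<close>

lemma reaching_eq_morse_basin:
  assumes "k \<le> l" "\<And>j. j \<in> {1..l} \<Longrightarrow> crit_value W (M j) < c \<longleftrightarrow> j \<le> k"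
  shows "reaching W c = morse_basin k"
proof (intro subset_antisym subsetI)
  fix x assume "x \<in> reaching W c"
  then obtain t where x: "x \<in> basin" "t \<ge> 0" "W (S t x) < c" by (auto simp: reaching_def)
  obtain j y where j: "j \<in> {1..l}" "y \<in> omega_limit S x" "y \<in> M j"
    using omega_limit_meets_morse_set[OF x(1)] .
  have "y \<in> basin" using j morse_set_subset attractor_subset_basin by blast
  then have "crit_value W (M j) < c"
    using omega_limit_value(1)[OF x(1) j(2) _ x(2)] x(3) crit_value_eq[OF j(1,3)] by simp
  then have "j \<in> {1..k}" using assms(2)[OF j(1)] j(1) by simp
  then show "x \<in> morse_basin k" using x(1) j by (auto simp: morse_basin_def)
next
  fix x assume "x \<in> morse_basin k"
  then obtain j y where x: "x \<in> basin" "j \<in> {1..k}" "y \<in> omega_limit S x" "y \<in> M j"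
    unfolding morse_basin_def by blast
  have j: "j \<in> {1..l}" using x(2) assms(1) by auto
  have "y \<in> basin" using x j morse_set_subset attractor_subset_basin by blast
  moreover have "W y < c" using assms(2)[OF j] x(2) crit_value_eq[OF j x(4)] by simp
  ultimately show "x \<in> reaching W c"
    using omega_limit_value(2)[OF x(1,3)] x(1) by (auto simp: reaching_def)
qed

text \<open>A point at level exactly \<open>c\<close> is in no Morse set, so it falls strictly below
  \<open>c\<close> by time 1.\<close>

lemma sublevel_subset_reaching:
  assumes "\<And>j. j \<in> {1..l} \<Longrightarrow> crit_value W (M j) \<noteq> c"
  shows "sublevel basin W c \<subseteq> reaching W c"
proof
  fix x assume "x \<in> sublevel basin W c"
  then have x: "x \<in> basin" "W x \<le> c" by (auto simp: sublevel_def)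
  show "x \<in> reaching W c"
  proof (cases "W x = c")
    case True
    then have "x \<notin> (\<Union>k\<in>{1..l}. M k)" using assms crit_value_eq by (metis UN_E)
    then have "W (S 1 x) < W (S 0 x)" by (intro W_strict[OF x(1)]) auto
    then show ?thesis using True x(1) by (auto simp: reaching_def intro!: exI[of _ 1])
  next
    case False
    then show ?thesis using x by (auto simp: reaching_def intro!: exI[of _ 0])
  qed
qed

lemma sublevel_invariant: "0 \<le> t \<Longrightarrow> x \<in> sublevel basin W c \<Longrightarrow> S t x \<in> sublevel basin W c"
  using W_antimono[of x 0 t] basin_invariant by (fastforce simp: sublevel_def)

lemma reaching_invariant:
  assumes "0 \<le> t" "x \<in> reaching W c"
  shows "S t x \<in> reaching W c"
proof -
  obtain s where s: "x \<in> basin" "s \<ge> 0" "W (S s x) < c" using assms(2) by (auto simp: reaching_def)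
  have "W (S s (S t x)) \<le> W (S s x)"
    using W_antimono[OF s(1,2), of "s + t"] S_add[OF s(2) assms(1)] assms(1) by simp
  then show ?thesis using s basin_invariant[OF assms(1) s(1)] by (force simp: reaching_def)
qed

text \<open>The conditions \<open>W (S (real n) x) < c\<close> weaken as \<open>n\<close> grows and
  cover \<open>K\<close>, so a finite subcover yields one time that works for all of
  \<open>K\<close>.\<close>

lemma compact_reaching_absorbed:
  assumes K: "compact K" "K \<subseteq> reaching W c"
  shows "\<exists>T\<ge>0. S T ` K \<subseteq> sublevel basin W c"
proof -
  \<comment> \<open>Continuity gives openness relative to the basin; extending to ambient open sets
    allows the cover to be used with compactness of \<open>K\<close>.\<close>
  have "\<exists>U. open U \<and> U \<inter> basin = (\<lambda>x. W (S (real n) x)) -` {..<c} \<inter> basin" for n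
  proof -
    have "continuous_on basin (\<lambda>x. W (S (real n) x))"
      by (rule continuous_on_compose2[OF continuous_W continuous_on_semiflow[OF semiflow]])
        (auto intro: basin_invariant)
    then show ?thesis unfolding continuous_on_open_invariant by (meson open_lessThan)
  qed
  then obtain U where U: "\<And>n. open (U n)" "\<And>n. U n \<inter> basin = (\<lambda>x. W (S (real n) x)) -` {..<c} \<inter> basin" by metis
  have cover: "K \<subseteq> (\<Union>n\<in>UNIV. U n)"
  proof
    fix x assume "x \<in> K"
    then obtain t where t: "x \<in> basin" "t \<ge> 0" "W (S t x) < c" using K(2) by (auto simp: reaching_def)
    obtain n where "t \<le> real n" using real_arch_simple by blast
    then have "W (S (real n) x) < c" using W_antimono[OF t(1,2), of "real n"] t(3) by linarith
    then have "x \<in> U n \<inter> basin" unfolding U(2) using t(1) by simp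
    then show "x \<in> (\<Union>n\<in>UNIV. U n)" by blast
  qed
  obtain N where N: "N \<subseteq> UNIV" "finite N" "K \<subseteq> (\<Union>n\<in>N. U n)"
    by (rule compactE_image[OF K(1) U(1) cover])
  \<comment> \<open>Inserting 0 keeps the maximum defined when the finite subcover is empty.\<close>
  define T where "T = real (Max (insert 0 N))"
  have "S T x \<in> sublevel basin W c" if x: "x \<in> K" for x
  proof -
    obtain n where n: "n \<in> N" "x \<in> U n" using N x by blast
    have x_basin: "x \<in> basin" using K(2) x by (auto simp: reaching_def)
    have "n \<le> Max (insert 0 N)" using N n by (intro Max_ge) auto
    then have "W (S T x) \<le> W (S (real n) x)" by (intro W_antimono x_basin) (auto simp: T_def)
    moreover have "x \<in> U n \<inter> basin" using n(2) x_basin by blast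
    then have "W (S (real n) x) < c" unfolding U(2) by simp
    ultimately show ?thesis using basin_invariant[OF _ x_basin, of T] by (simp add: sublevel_def T_def)
  qed
  then show ?thesis by (intro exI[of _ T]) (auto simp: T_def)
qed

lemma sublevel_pair_rank:
  assumes "i \<le> k" "k \<le> l" "a \<le> b"
    and a: "\<And>j. j \<in> {1..l} \<Longrightarrow> crit_value W (M j) < a \<longleftrightarrow> j \<le> i" "\<And>j. j \<in> {1..l} \<Longrightarrow> crit_value W (M j) \<noteq> a"
    and b: "\<And>j. j \<in> {1..l} \<Longrightarrow> crit_value W (M j) < b \<longleftrightarrow> j \<le> k" "\<And>j. j \<in> {1..l} \<Longrightarrow> crit_value W (M j) \<noteq> b"
  shows "ab_rank (coeff_relhomology q (top_of_set (sublevel basin W b)) (sublevel basin W a) :: ('a, 'g::ab_group_add) gchain set monoid)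
    = quotient_rank (rel_cycles q (morse_basin k) (morse_basin i) :: ('a, 'g) gchain set) (rel_boundaries q (morse_basin k) (morse_basin i))"
proof -
  have sub: "sublevel basin W a \<subseteq> sublevel basin W b" using \<open>a \<le> b\<close> by (auto simp: sublevel_def)
  have eq: "reaching W b = morse_basin k" "reaching W a = morse_basin i"
    using reaching_eq_morse_basin[of k b] reaching_eq_morse_basin[of i a] assms by auto
  have "reaching W a \<subseteq> reaching W b" using \<open>a \<le> b\<close> by (force simp: reaching_def)
  then show ?thesis
    unfolding ab_rank_coeff_relhomology[OF sub] eq[symmetric]
    by (intro absorbing_pair_rank_eq[OF semiflow sub] sublevel_subset_reaching a b
        sublevel_invariant reaching_invariant compact_reaching_absorbed)
qed

end

text \<open>The window of levels isolates one critical value, so \<open>k - 1\<close> of them lie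
  below its lower end and \<open>k\<close> below its upper end, whichever function was
  chosen.\<close>

lemma critical_group_rank:
  assumes k: "k \<in> {1..l}" and C: "critical_groups S basin l M k (C :: nat \<Rightarrow> ('a, 'g::ab_group_add) gchain set monoid)"
  shows "ab_rank (C q) = quotient_rank (rel_cycles q (morse_basin k) (morse_basin (k - 1)) :: ('a, 'g) gchain set)
    (rel_boundaries q (morse_basin k) (morse_basin (k - 1)))"
proof -
  obtain W a b where W: "strict_morse_lyapunov S basin l M W" "a < crit_value W (M k)" "crit_value W (M k) < b"
    "(\<lambda>j. crit_value W (M j)) ` {1..l} \<inter> {a..b} = {crit_value W (M k)}"
    and C_eq: "C = (\<lambda>q. coeff_relhomology q (top_of_set (sublevel basin W b)) (sublevel basin W a))"
    using C unfolding critical_groups_def by blast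
  let ?c = "\<lambda>j. crit_value W (M j)"
  have lyap: "morse_lyapunov S basin l M W" and mono: "strict_mono_on {1..l} ?c"
    using W(1) by (auto simp: strict_morse_lyapunov_def)
  have less: "?c i < ?c j" if "i \<in> {1..l}" "j \<in> {1..l}" "i < j" for i j
    using mono that by (auto simp: strict_mono_on_def monotone_on_def)
  have out: "?c j < a \<or> b < ?c j" if "j \<in> {1..l}" "j \<noteq> k" for j
  proof (rule ccontr)
    assume "\<not> ?thesis"
    then have "?c j = ?c k" using W(4) that(1) by auto
    then show False using less[OF that(1) k] less[OF k that(1)] that(2) by (metis less_irrefl linorder_neqE_nat)
  qed
  have *: "?c j < a \<and> ?c j < b" if "j \<in> {1..l}" "j < k" for j
    using out[of j] less[OF that(1) k that(2)] W(2,3) that by auto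
  have **: "a < ?c j \<and> b < ?c j" if "j \<in> {1..l}" "k < j" for j
    using out[of j] less[OF k that(1) that(2)] W(2,3) that by auto
  show ?thesis
    unfolding C_eq
  proof (rule sublevel_pair_rank[OF lyap])
    fix j assume j: "j \<in> {1..l}"
    consider "j < k" | "j = k" | "k < j" by linarith
    then have "(?c j < a \<longleftrightarrow> j \<le> k - 1) \<and> ?c j \<noteq> a \<and> (?c j < b \<longleftrightarrow> j \<le> k) \<and> ?c j \<noteq> b"
    proof cases
      case 1 then show ?thesis using *[OF j] by auto
    next
      case 2 then show ?thesis using W(2,3) k by auto
    next
      case 3 then show ?thesis using **[OF j] by auto
    qed
    then show "?c j < a \<longleftrightarrow> j \<le> k - 1" "?c j \<noteq> a" "?c j < b \<longleftrightarrow> j \<le> k" "?c j \<noteq> b" by auto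
  qed (use k W(2,3) in auto)
qed

lemma morse_basin_0 [simp]: "morse_basin 0 = {}"
  by (simp add: morse_basin_def)

lemma morse_basin_mono: "i \<le> k \<Longrightarrow> morse_basin i \<subseteq> morse_basin k"
  by (fastforce simp: morse_basin_def)

text \<open>Each enlargement of the filtration contributes the equation of a triple with empty third
  member. The homology of the previous stage is substituted rather than cancelled, and the
  connecting ranks add up.\<close>

lemma filtration_ranks:
  obtains D where "D 0 = 0" and
    "\<And>q. (\<Sum>j=1..k. quotient_rank (rel_cycles q (morse_basin j) (morse_basin (j - 1)) :: ('a, 'g::ab_group_add) gchain set)
          (rel_boundaries q (morse_basin j) (morse_basin (j - 1))))
        = quotient_rank (rel_cycles q (morse_basin k) {} :: ('a, 'g) gchain set) (rel_boundaries q (morse_basin k) {})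
          + D q + D (Suc q)"
proof (induction k arbitrary: thesis)
  case 0
  have "quotient_rank (rel_cycles q {} {} :: ('a, 'g) gchain set) (rel_boundaries q {} {}) = 0" for q
  proof -
    have "c \<in> rel_boundaries q {} {}" if "c \<in> rel_cycles q {} {}" for c :: "('a, 'g) gchain"
      using that add_subgroup_uminus[OF add_subgroup_coeff_chain, of c q]
      by (intro rel_boundariesI[of 0]) (auto simp: rel_cycles_def)
    then have "rel_cycles q {} {} = (rel_boundaries q {} {} :: ('a, 'g) gchain set)"
      using rel_boundaries_subset_cycles[of "{}" "{}" q] by blast
    then show ?thesis by (simp add: quotient_rank_self[OF add_subgroup_rel_boundaries])
  qed
  then show ?case by (intro 0[of "\<lambda>_. 0"]) simp_all
next
  case (Suc k)
  obtain D where D: "D 0 = 0" "\<And>q. (\<Sum>j=1..k. quotient_rank (rel_cycles q (morse_basin j) (morse_basin (j - 1)) :: ('a, 'g) gchain set)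
          (rel_boundaries q (morse_basin j) (morse_basin (j - 1))))
        = quotient_rank (rel_cycles q (morse_basin k) {} :: ('a, 'g) gchain set) (rel_boundaries q (morse_basin k) {})
          + D q + D (Suc q)"
    using Suc.IH by blast
  obtain E where E: "E 0 = 0" "\<And>q. quotient_rank (rel_cycles q (morse_basin (Suc k)) (morse_basin k) :: ('a, 'g) gchain set)
        (rel_boundaries q (morse_basin (Suc k)) (morse_basin k))
      + quotient_rank (rel_cycles q (morse_basin k) {} :: ('a, 'g) gchain set) (rel_boundaries q (morse_basin k) {})
      = quotient_rank (rel_cycles q (morse_basin (Suc k)) {} :: ('a, 'g) gchain set) (rel_boundaries q (morse_basin (Suc k)) {})
        + E q + E (Suc q)"
    using quotient_rank_triple[of "{}" "morse_basin k" "morse_basin (Suc k)"] morse_basin_mono[of k "Suc k"] by auto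
  show ?case
  proof (rule Suc.prems[of "\<lambda>q. D q + E q"])
    fix q
    show "(\<Sum>j=1..Suc k. quotient_rank (rel_cycles q (morse_basin j) (morse_basin (j - 1)) :: ('a, 'g) gchain set)
          (rel_boundaries q (morse_basin j) (morse_basin (j - 1))))
        = quotient_rank (rel_cycles q (morse_basin (Suc k)) {} :: ('a, 'g) gchain set) (rel_boundaries q (morse_basin (Suc k)) {})
          + (D q + E q) + (D (Suc q) + E (Suc q))"
      using D(2)[of q] E(2)[of q] by (simp add: ac_simps)
  qed (use D(1) E(1) in simp)
qed

end

section \<open>Morse inequalities\<close>

text \<open>Every \<open>D j\<close> occurs in two consecutive degrees with opposite signs; only the
  top one survives, as \<open>D 0 = 0\<close>.\<close>

lemma alternating_sum_defect:
  fixes m \<beta> D :: "nat \<Rightarrow> nat"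
  assumes "\<And>q. m q = \<beta> q + D q + D (Suc q)" "D 0 = 0"
  shows "(\<Sum>j\<le>q. (-1) ^ (q - j) * int (m j)) = (\<Sum>j\<le>q. (-1) ^ (q - j) * int (\<beta> j)) + int (D (Suc q))"
proof (induction q)
  case (Suc q)
  have s: "(\<Sum>j\<le>Suc q. (-1) ^ (Suc q - j) * int (f j)) = int (f (Suc q)) - (\<Sum>j\<le>q. (-1) ^ (q - j) * int (f j))" for f
    by (simp add: Suc_diff_le sum_negf)
  show ?case unfolding s Suc by (simp add: assms(1)[of "Suc q"])
qed (simp add: assms)

text \<open>The terms of a convergent series tend to 0, so the natural numbers \<open>m q\<close>
  vanish eventually, hence also \<open>D q\<close>, and the partial sums of both series eventually
  agree.\<close>

lemma alternating_series_defect: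
  fixes m \<beta> D :: "nat \<Rightarrow> nat"
  assumes mD: "\<And>q. m q = \<beta> q + D q + D (Suc q)" "D 0 = 0"
    and summ: "summable (\<lambda>q. (-1) ^ q * real (m q))"
  shows "(\<lambda>q. (-1) ^ q * real (\<beta> q)) sums suminf (\<lambda>q. (-1) ^ q * real (m q))"
proof -
  have partial: "(\<Sum>j<n. (-1) ^ j * real (\<beta> j)) = (\<Sum>j<n. (-1) ^ j * real (m j)) + (-1) ^ n * real (D n)" for n
    by (induction n) (simp_all add: mD algebra_simps)
  have "(\<lambda>q. (-1) ^ q * real (m q)) \<longlonglongrightarrow> 0" by (rule summable_LIMSEQ_zero[OF summ])
  then have "(\<lambda>q. \<bar>(-1) ^ q * real (m q)\<bar>) \<longlonglongrightarrow> 0" by (rule tendsto_rabs_zero)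
  then have "eventually (\<lambda>q. \<bar>(-1) ^ q * real (m q)\<bar> < 1) sequentially" by (rule order_tendstoD) simp
  then have "eventually (\<lambda>q. D q = 0) sequentially"
    by eventually_elim (use mD(1) in \<open>auto simp: abs_mult power_abs\<close>)
  then have "eventually (\<lambda>n. (\<Sum>j<n. (-1) ^ j * real (m j)) = (\<Sum>j<n. (-1) ^ j * real (\<beta> j))) sequentially"
    by eventually_elim (simp add: partial)
  then show ?thesis
    using summable_LIMSEQ[OF summ] unfolding sums_def by (rule Lim_transform_eventually[rotated])
qed

theorem theorem6p6:
  fixes S :: "real \<Rightarrow> 'a::complete_space \<Rightarrow> 'a"
    and \<A> \<Omega> :: "'a set"
    and l :: nat
    and M :: "nat \<Rightarrow> 'a set"
    and V :: "'a \<Rightarrow> real"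
    and a b :: real
    and C :: "nat \<Rightarrow> nat \<Rightarrow> ('a, 'g::ab_group_add) gchain set monoid"
    and m \<beta> :: "nat \<Rightarrow> enat"
  assumes "semiflow S"
    and "asymptotically_compact S"
    and "attractor S \<A>"
    and "\<Omega> = attraction_basin S \<A>"
    and "morse_decomposition S \<A> l M"
    and "strict_morse_lyapunov S \<Omega> l M V"
    and "\<And>k. k \<in> {1..l} \<Longrightarrow> a < crit_value V (M k) \<and> crit_value V (M k) < b"
    and "\<And>k. k \<in> {1..l} \<Longrightarrow> critical_groups S \<Omega> l M k (C k)"
    and "\<And>q. m q = (\<Sum>k=1..l. ab_rank (C k q))"
    and "\<And>q. \<beta> q = ab_rank (coeff_relhomology q (top_of_set (sublevel \<Omega> V b)) (sublevel \<Omega> V a)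
                        :: ('a, 'g) gchain set monoid)"
    and "\<And>k q. k \<in> {1..l} \<Longrightarrow> ab_rank (C k q) < \<infinity>"
  shows "(\<forall>q. \<beta> q = ab_rank (coeff_homology q (top_of_set (sublevel \<Omega> V b))
                        :: ('a, 'g) gchain set monoid)) \<and>
    (\<forall>q. \<beta> q < \<infinity>) \<and>
    (\<forall>q. (\<Sum>j\<le>q. (-1) ^ (q - j) * int (the_enat (m j)))
             \<ge> (\<Sum>j\<le>q. (-1) ^ (q - j) * int (the_enat (\<beta> j)))) \<and>
    (summable (\<lambda>q. (-1) ^ q * real (the_enat (m q))) \<longrightarrow>
         (\<lambda>q. (-1) ^ q * real (the_enat (\<beta> q))) sums suminf (\<lambda>q. (-1) ^ q * real (the_enat (m q))))"
proof -
  interpret morse_setting S \<A> l M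
    using assms(1,3,5) by unfold_locales
  have lyap: "morse_lyapunov S basin l M V"
    using assms(4,6) by (simp add: strict_morse_lyapunov_def)
  have levels: "a < crit_value V (M j)" "crit_value V (M j) < b" if "j \<in> {1..l}" for j
    using assms(7)[OF that] by simp_all
  \<comment> \<open>No critical value lies below \<open>a\<close>, so a point at or below this level
    would belong to \<open>morse_basin 0\<close>, which is empty.\<close>
  have V_a: "sublevel \<Omega> V a = {}"
  proof -
    have "sublevel basin V a \<subseteq> reaching V a"
      by (rule sublevel_subset_reaching[OF lyap]) (use levels(1) in \<open>auto dest: less_imp_neq\<close>)
    also have "reaching V a = morse_basin 0"
      by (rule reaching_eq_morse_basin[OF lyap]) (use levels(1) in \<open>auto dest: less_asym\<close>)
    finally show ?thesis by (simp add: assms(4))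
  qed
  have \<beta>: "\<beta> q = quotient_rank (rel_cycles q (morse_basin l) {} :: ('a, 'g) gchain set) (rel_boundaries q (morse_basin l) {})" for q
  proof -
    \<comment> \<open>When \<open>l = 0\<close> the hypotheses do not order \<open>a\<close> and
      \<open>b\<close>. Since the sublevel set at \<open>a\<close> is empty, raising
      \<open>b\<close> to \<open>a\<close> does not change the sublevel set at
      \<open>b\<close>.\<close>
    define b' where "b' = max a b"
    have b': "a \<le> b'" "sublevel \<Omega> V b = sublevel \<Omega> V b'"
      using V_a by (auto simp: b'_def max_def sublevel_def)
    show ?thesis
      unfolding assms(10) b'(2) unfolding assms(4) morse_basin_0[symmetric]
    proof (rule sublevel_pair_rank[OF lyap])
      fix j assume j: "j \<in> {1..l}"
      show "crit_value V (M j) < a \<longleftrightarrow> j \<le> 0" "crit_value V (M j) \<noteq> a"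
        "crit_value V (M j) < b' \<longleftrightarrow> j \<le> l" "crit_value V (M j) \<noteq> b'"
        using levels[OF j] j by (auto simp: b'_def)
    qed (use b' in simp_all)
  qed
  obtain D where D: "D 0 = 0" "\<And>q. (\<Sum>j=1..l. quotient_rank (rel_cycles q (morse_basin j) (morse_basin (j - 1)) :: ('a, 'g) gchain set)
          (rel_boundaries q (morse_basin j) (morse_basin (j - 1))))
        = quotient_rank (rel_cycles q (morse_basin l) {} :: ('a, 'g) gchain set) (rel_boundaries q (morse_basin l) {})
          + D q + D (Suc q)"
    using filtration_ranks by blast
  have m_eq: "m q = \<beta> q + D q + D (Suc q)" for q
    unfolding assms(9) \<beta> D(2)[symmetric]
    using critical_group_rank assms(4,8) by (intro sum.cong) auto
  have m_fin: "m q < \<infinity>" for q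
  proof -
    have "(\<Sum>k\<in>K. ab_rank (C k q)) < \<infinity>" if "finite K" "K \<subseteq> {1..l}" for K
      using that
    proof (induction K rule: finite_induct)
      case (insert k K)
      then have "ab_rank (C k q) < \<infinity>" "(\<Sum>k\<in>K. ab_rank (C k q)) < \<infinity>"
        using assms(11)[of k q] by simp_all
      then show ?case using insert(1,2) by (auto elim!: less_infinityE)
    qed simp
    from this[of "{1..l}"] show ?thesis by (simp add: assms(9))
  qed
  have fin: "\<beta> q < \<infinity>" "D q < \<infinity>" for q
  proof -
    have "\<beta> q \<le> m q" "D q \<le> m q"
      unfolding m_eq[of q] by (simp_all add: add.commute add.left_commute add_increasing)
    then show "\<beta> q < \<infinity>" "D q < \<infinity>" using m_fin[of q] by (blast intro: le_less_trans)+
  qed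
  \<comment> \<open>\<open>the_enat\<close> respects sums only for finite values, so this waits for
    the bounds by \<open>m q\<close>.\<close>
  have nat_eq: "the_enat (m q) = the_enat (\<beta> q) + the_enat (D q) + the_enat (D (Suc q))" for q
    using m_eq[of q] fin(1)[of q] fin(2)[of q] fin(2)[of "Suc q"] by auto
  have D0: "the_enat (D 0) = 0" by (simp add: D(1) zero_enat_def)
  show ?thesis
  proof (intro conjI allI impI)
    show "\<beta> q = ab_rank (coeff_homology q (top_of_set (sublevel \<Omega> V b)) :: ('a, 'g) gchain set monoid)" for q
      by (simp add: assms(10) V_a)
    show "\<beta> q < \<infinity>" for q by (rule fin)
    show "(\<Sum>j\<le>q. (-1) ^ (q - j) * int (the_enat (m j))) \<ge> (\<Sum>j\<le>q. (-1) ^ (q - j) * int (the_enat (\<beta> j)))" for q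
      using alternating_sum_defect[of "\<lambda>q. the_enat (m q)" "\<lambda>q. the_enat (\<beta> q)" "\<lambda>q. the_enat (D q)", OF nat_eq D0]
      by simp
    show "(\<lambda>q. (-1) ^ q * real (the_enat (\<beta> q))) sums suminf (\<lambda>q. (-1) ^ q * real (the_enat (m q)))"
      if "summable (\<lambda>q. (-1) ^ q * real (the_enat (m q)))"
      using alternating_series_defect[of "\<lambda>q. the_enat (m q)" "\<lambda>q. the_enat (\<beta> q)" "\<lambda>q. the_enat (D q)", OF nat_eq D0 that] .
  qed
qed

end
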